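(* Let $L_0 > \bar L_0 = \frac12 e^{2+\gamma}$. Then there exists $\bar\delta_0 > 0$ such that for every $\bar\delta>0$ with $\bar\delta < \bar\delta_0$, minimizers of the energy $F_2(\{\rho_n,\theta_n,\mathbf r_n\})$ among all $\rho_1,\rho_2\in(0,L_0^{-1})$, $\theta_1,\theta_2\in[-\pi,\pi)$ and $\mathbf r_1,\mathbf r_2\in\mathbb R^2$ exist, and every minimizer satisfies: (i) $\mathbf r_1 = \mathbf r_2$; (ii) $\theta_1 = 0$ and $\theta_2 = -\pi$; (iii) $\rho_1 = \rho_2 = \rho$, where $$\rho = \frac{(16+\pi^2)\,\bar\delta}{-64\,W_{-1}\left(-\frac{16+\pi^2}{128}e^{1+\gamma}\,\bar\delta\right)}.$$
   Context: Here $\gamma$ is the Euler–Mascheroni constant, and $W_{-1}$ is the lower real branch of the Lambert $W$ function, i.e., for $t\in[-1/e,0)$, $w = W_{-1}(t)$ is the solution of $we^w=t$ with $w\le -1$. $J_0$ is the Bessel function of the first kind of order $0$; $K_0, K_1$ are the modified Bessel functions of the second kind of orders $0$ and $1$. For $\alpha > 0$ and $\lambda \geq 0$ define $$F_{vv}(\alpha,\lambda) = \frac{32}{3\pi^2}\int_0^\infty \xi^2 J_0(\lambda\xi) K_1(\alpha\xi)K_1(\xi/\alpha)\,d\xi,$$ $$F_{ss}(\alpha,\lambda) = \frac{32}{\pi^2}\int_0^\infty \xi^2 J_0(\lambda\xi) K_0(\alpha\xi)K_0(\xi/\alpha)\,d\xi,$$ $$F_{vs}(\alpha,\lambda) = 2\int_0^\infty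 \xi^2 J_0(\lambda\xi) K_0(\alpha\xi)K_1(\xi/\alpha)\,d\xi.$$ For $\bar\delta>0$, $\rho_1,\rho_2>0$, $\theta_1,\theta_2\in[-\pi,\pi)$ and $\mathbf r_1,\mathbf r_2\in\mathbb R^2$, set $\alpha=\sqrt{\rho_2/\rho_1}$ and $\lambda = |\mathbf r_2-\mathbf r_1|/\sqrt{\rho_1\rho_2}$. The energy of a skyrmion pair in a bilayer (no DMI, no applied field) is $$\begin{aligned} F_2(\{\rho_n,\theta_n,\mathbf r_n\}) &= \sum_{n=1}^2\left[-4\pi\rho_n^2\ln\left(\frac{e^{1+2\gamma}}{4}\rho_n^2\right) + \bar\delta\,\frac{\pi^3}{8}\rho_n(3\cos^2\theta_n - 1)\right]\\ &+\bar\delta\,\frac{\pi^3}{4}\sqrt{\rho_1\rho_2}\left[3\cos\theta_1\cos\theta_2\,F_{vv}(\alpha,\lambda) - F_{ss}(\alpha,\lambda)\right]\\ &-4\pi\bar\delta\sqrt{\rho_1\rho_2}\left[\cos\theta_1\,F_{vs}(\alpha,\lambda) - \cos\theta_2\,F_{vs}(\alpha^{-1},\lambda)\right]. \end{aligned}$$ *)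

theory Defs
  imports "HOL-Analysis.Analysis"
begin

definition bessel_J :: "nat \<Rightarrow> real \<Rightarrow> real" where
  "bessel_J n x = (\<Sum>k. (-1) ^ k / (fact k * fact (k + n)) * (x / 2) ^ (2 * k + n))"

text \<open>Modified Bessel function of the second kind, by its classical integral representation;
  only meaningful for \<open>x > 0\<close>.\<close>

definition bessel_K :: "nat \<Rightarrow> real \<Rightarrow> real" where
  "bessel_K n x = (LBINT t:{0<..}. exp (- x * cosh t) * cosh (real n * t))"

text \<open>Lower real branch of the Lambert function; the description is proper exactly for
  \<open>- exp (-1) \<le> t < 0\<close>.\<close>

definition lambert_W_m1 :: "real \<Rightarrow> real" where
  "lambert_W_m1 t = (THE w. w \<le> -1 \<and> w * exp w = t)"

definition F_vv :: "real \<Rightarrow> real \<Rightarrow> real" where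
  "F_vv \<alpha> l = 32 / (3 * pi\<^sup>2) *
     (LBINT \<xi>:{0<..}. \<xi>\<^sup>2 * bessel_J 0 (l * \<xi>) * bessel_K 1 (\<alpha> * \<xi>) * bessel_K 1 (\<xi> / \<alpha>))"

definition F_ss :: "real \<Rightarrow> real \<Rightarrow> real" where
  "F_ss \<alpha> l = 32 / pi\<^sup>2 *
     (LBINT \<xi>:{0<..}. \<xi>\<^sup>2 * bessel_J 0 (l * \<xi>) * bessel_K 0 (\<alpha> * \<xi>) * bessel_K 0 (\<xi> / \<alpha>))"

definition F_vs :: "real \<Rightarrow> real \<Rightarrow> real" where
  "F_vs \<alpha> l = 2 *
     (LBINT \<xi>:{0<..}. \<xi>\<^sup>2 * bessel_J 0 (l * \<xi>) * bessel_K 0 (\<alpha> * \<xi>) * bessel_K 1 (\<xi> / \<alpha>))"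

text \<open>The part of the energy depending on a single layer.\<close>

definition layer_energy :: "real \<Rightarrow> real \<Rightarrow> real \<Rightarrow> real" where
  "layer_energy \<delta> \<rho> \<theta> =
     - 4 * pi * \<rho>\<^sup>2 * ln (exp (1 + 2 * euler_mascheroni) / 4 * \<rho>\<^sup>2)
     + \<delta> * (pi ^ 3 / 8) * \<rho> * (3 * (cos \<theta>)\<^sup>2 - 1)"

text \<open>A configuration is a tuple \<open>(\<rho>\<^sub>1, \<rho>\<^sub>2, \<theta>\<^sub>1, \<theta>\<^sub>2, r\<^sub>1, r\<^sub>2)\<close> of skyrmion radii, rotation
  angles and centres.\<close>

type_synonym config = "real \<times> real \<times> real \<times> real \<times> (real^2) \<times> (real^2)"

fun F2 :: "real \<Rightarrow> config \<Rightarrow> real" where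
  "F2 \<delta> (\<rho>1, \<rho>2, \<theta>1, \<theta>2, r1, r2) =
     (let \<alpha> = sqrt (\<rho>2 / \<rho>1); l = norm (r2 - r1) / sqrt (\<rho>1 * \<rho>2) in
        layer_energy \<delta> \<rho>1 \<theta>1 + layer_energy \<delta> \<rho>2 \<theta>2
        + \<delta> * (pi ^ 3 / 4) * sqrt (\<rho>1 * \<rho>2) *
            (3 * cos \<theta>1 * cos \<theta>2 * F_vv \<alpha> l - F_ss \<alpha> l)
        - 4 * pi * \<delta> * sqrt (\<rho>1 * \<rho>2) *
            (cos \<theta>1 * F_vs \<alpha> l - cos \<theta>2 * F_vs (inverse \<alpha>) l))"

definition admissible :: "real \<Rightarrow> config set" where
  "admissible L0 =
     {0<..<inverse L0} \<times> {0<..<inverse L0} \<times> {-pi..<pi} \<times> {-pi..<pi} \<times> UNIV \<times> UNIV"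

abbreviation is_minimizer :: "real \<Rightarrow> real \<Rightarrow> config \<Rightarrow> bool" where
  "is_minimizer L0 \<delta> c \<equiv> is_arg_min (F2 \<delta>) (\<lambda>c. c \<in> admissible L0) c"

end

theory Submission
  imports Defs "HOL-Probability.Distributions" "HOL-Real_Asymp.Real_Asymp"
begin

text \<open>Since \<open>\<bar>J\<^sub>0\<bar> \<le> 1\<close> with equality only at the origin and \<open>K\<^sub>0\<close>, \<open>K\<^sub>1\<close> are positive, all
  interaction integrals are dominated by their values at \<open>\<lambda> = 0\<close>. There AM-GM gives
  \<open>F\<^sub>v\<^sub>v, F\<^sub>s\<^sub>s \<le> 1\<close>, and the two linear relations \<open>a P + b Q = 1\<close>, \<open>a Q + b P = 2 I\<close> between
  \<open>P = \<integral> \<xi>\<^sup>2 K\<^sub>0(a \<xi>) K\<^sub>1(b \<xi>)\<close>, \<open>Q = \<integral> \<xi>\<^sup>2 K\<^sub>1(a \<xi>) K\<^sub>0(b \<xi>)\<close> and \<open>I = \<integral> \<xi> K\<^sub>0(a \<xi>) K\<^sub>0(b \<xi>) \<le> 1/2\<close>,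
  where \<open>a = \<alpha>\<close> and \<open>b = 1/\<alpha>\<close>, give \<open>F\<^sub>v\<^sub>s(\<alpha>) + F\<^sub>v\<^sub>s(1/\<alpha>) \<le> 2\<close>. With \<open>2 \<surd>(\<rho>\<^sub>1 \<rho>\<^sub>2) \<le> \<rho>\<^sub>1 + \<rho>\<^sub>2\<close>
  the energy is therefore bounded below by a sum of two copies of a function of a single radius,
  with equality at equal radii only in the configuration described in the theorem. That function
  is strictly convex on the admissible interval, and its critical point is expressed by the
  Lambert function.\<close>

subsection \<open>Integrals of powers of the hyperbolic secant\<close>

lemma nn_integral_even:
  fixes f :: "real \<Rightarrow> ennreal"
  assumes [measurable]: "f \<in> borel_measurable borel" and even: "\<And>x. f (-x) = f x"
  shows "(\<integral>\<^sup>+x. f x \<partial>lborel) = 2 * (\<integral>\<^sup>+x. f x * indicator {0..} x \<partial>lborel)"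
proof -
  have "(\<integral>\<^sup>+x. f x \<partial>lborel) = (\<integral>\<^sup>+x. f x * indicator {0..} x + f x * indicator {..<0} x \<partial>lborel)"
    by (intro nn_integral_cong) (auto split: split_indicator)
  also have "\<dots> = (\<integral>\<^sup>+x. f x * indicator {0..} x \<partial>lborel) + (\<integral>\<^sup>+x. f x * indicator {..<0} x \<partial>lborel)"
    by (intro nn_integral_add) auto
  also have "(\<integral>\<^sup>+x. f x * indicator {..<0} x \<partial>lborel) = (\<integral>\<^sup>+x. f x * indicator {0<..} x \<partial>lborel)"
    by (subst nn_integral_real_affine[where c="-1" and t=0])
      (auto simp: even intro!: nn_integral_cong split: split_indicator)
  also have "\<dots> = (\<integral>\<^sup>+x. f x * indicator {0..} x \<partial>lborel)"
    using AE_lborel_singleton[of "0::real"]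
    by (intro nn_integral_cong_AE) (auto split: split_indicator)
  finally show ?thesis by (simp add: mult_2)
qed

text \<open>Since \<open>F 0 = 0\<close>, the half-line contributes the limit \<open>T\<close>, and
  evenness doubles it. Nonnegative integrals give finiteness and the value at once.\<close>

lemma nn_integral_real_even:
  fixes f F :: "real \<Rightarrow> real"
  assumes "f \<in> borel_measurable borel" "\<And>x. f (-x) = f x" "\<And>x. 0 \<le> f x"
    "\<And>x. DERIV F x :> f x" "(F \<longlongrightarrow> T) at_top" "F 0 = 0"
  shows "(\<integral>\<^sup>+x. ennreal (f x) \<partial>lborel) = ennreal (2 * T)"
  using assms nn_integral_FTC_atLeast[of f 0 F T]
  by (subst nn_integral_even) (auto simp: ennreal_mult')

lemma borel_measurable_cosh [measurable]:
  fixes f :: "'a \<Rightarrow> real"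
  assumes [measurable]: "f \<in> borel_measurable M"
  shows "(\<lambda>x. cosh (f x)) \<in> borel_measurable M"
  unfolding cosh_def by measurable

text \<open>The antiderivative \<open>arctan (sinh x)\<close> is the Gudermannian function.\<close>

lemma nn_integral_sech: "(\<integral>\<^sup>+x. ennreal (1 / cosh x) \<partial>lborel) = ennreal pi"
proof -
  have "((\<lambda>x. arctan (sinh x)) \<longlongrightarrow> pi / 2) at_top"
    by (rule filterlim_compose[OF tendsto_arctan_at_top]) real_asymp
  moreover have "DERIV (\<lambda>x. arctan (sinh x)) x :> 1 / cosh x" for x :: real
  proof -
    have "1 + (sinh x)\<^sup>2 = (cosh x)\<^sup>2" by (simp add: cosh_square_eq)
    moreover have "DERIV (\<lambda>x. arctan (sinh x)) x :> inverse (1 + (sinh x)\<^sup>2) * cosh x"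
      by (auto intro!: derivative_eq_intros)
    ultimately show ?thesis by (simp add: power2_eq_square field_simps)
  qed
  ultimately show ?thesis
    using nn_integral_real_even[of "\<lambda>x. 1 / cosh x" "\<lambda>x. arctan (sinh x)" "pi/2"] by auto
qed

lemma nn_integral_sech_square: "(\<integral>\<^sup>+x. ennreal (1 / (cosh x)\<^sup>2) \<partial>lborel) = ennreal 2"
proof -
  have "DERIV tanh x :> 1 / (cosh x)\<^sup>2" for x :: real
  proof -
    have "1 - (tanh x)\<^sup>2 = ((cosh x)\<^sup>2 - (sinh x)\<^sup>2) / (cosh x)\<^sup>2"
      by (simp add: tanh_def power_divide diff_divide_distrib)
    then have "1 - (tanh x)\<^sup>2 = 1 / (cosh x)\<^sup>2" by (simp only: hyperbolic_pythagoras)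
    moreover have "DERIV tanh x :> 1 - (tanh x)\<^sup>2"
      by (auto intro!: derivative_eq_intros)
    ultimately show ?thesis by simp
  qed
  then show ?thesis
    using nn_integral_real_even[of "\<lambda>x. 1 / (cosh x)\<^sup>2" tanh 1] tanh_real_at_top by auto
qed

lemma nn_integral_sech_cube: "(\<integral>\<^sup>+x. ennreal (1 / (cosh x)^3) \<partial>lborel) = ennreal (pi / 2)"
proof -
  \<comment> \<open>One step of the reduction formula for powers of the hyperbolic secant, with the
    Gudermannian function as the remaining term. Its limit at infinity is
    \<open>pi / 4\<close>.\<close>
  let ?F = "\<lambda>x::real. (sinh x / (cosh x)\<^sup>2 + arctan (sinh x)) / 2"
  have "((\<lambda>x::real. arctan (sinh x)) \<longlongrightarrow> pi / 2) at_top"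
    by (rule filterlim_compose[OF tendsto_arctan_at_top]) real_asymp
  moreover have "((\<lambda>x::real. sinh x / (cosh x)\<^sup>2) \<longlongrightarrow> 0) at_top"
    by real_asymp
  ultimately have "(?F \<longlongrightarrow> (0 + pi / 2) / 2) at_top"
    by (intro tendsto_intros) auto
  moreover have "DERIV ?F x :> 1 / (cosh x)^3" for x :: real
  proof -
    have "DERIV ?F x :> ((cosh x * (cosh x)\<^sup>2 - sinh x * (2 * cosh x * sinh x)) / ((cosh x)\<^sup>2)\<^sup>2
        + cosh x / (1 + (sinh x)\<^sup>2)) / 2"
      by (auto intro!: derivative_eq_intros simp: power2_eq_square field_simps)
    also have "1 + (sinh x)\<^sup>2 = (cosh x)\<^sup>2" by (simp add: cosh_square_eq)
    also have "sinh x * (2 * cosh x * sinh x) = 2 * cosh x * ((cosh x)\<^sup>2 - 1)"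
      using hyperbolic_pythagoras[of x] by (simp add: power2_eq_square algebra_simps)
    also have "((cosh x * (cosh x)\<^sup>2 - 2 * cosh x * ((cosh x)\<^sup>2 - 1)) / ((cosh x)\<^sup>2)\<^sup>2
        + cosh x / (cosh x)\<^sup>2) / 2 = 1 / (cosh x)^3"
      using cosh_real_pos[of x] by (simp add: field_simps) (simp add: eval_nat_numeral algebra_simps)
    finally show ?thesis .
  qed
  ultimately show ?thesis
    using nn_integral_real_even[of "\<lambda>x. 1 / (cosh x)^3" ?F "pi/4"] by auto
qed

text \<open>The Gamma integral, rescaled by \<open>c\<close>. It integrates out \<xi> once the
  Bessel functions are written as integrals of exponentials.\<close>

lemma nn_integral_power_exp:
  fixes c :: real
  assumes "c > 0"
  shows "(\<integral>\<^sup>+x. ennreal (x ^ k * exp (- (x * c))) * indicator {0<..} x \<partial>lborel) = ennreal (fact k / c ^ Suc k)"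
proof -
  have "ennreal (fact k) = (\<integral>\<^sup>+x. ennreal (x ^ k * exp (- x)) * indicator {0..} x \<partial>lborel)"
    by (simp add: nn_intergal_power_times_exp_Ici)
  also have "\<dots> = c * (\<integral>\<^sup>+x. ennreal ((c * x) ^ k * exp (- (c * x))) * indicator {0..} (c * x) \<partial>lborel)"
    using assms by (subst nn_integral_real_affine[where c=c and t=0]) auto
  also have "\<dots> = c * (\<integral>\<^sup>+x. ennreal (c ^ k) * (ennreal (x ^ k * exp (- (x * c))) * indicator {0<..} x) \<partial>lborel)"
    using assms AE_lborel_singleton[of "0::real"]
    by (intro arg_cong2[where f="(*)"] refl nn_integral_cong_AE)
      (auto simp: ennreal_mult'[symmetric] power_mult_distrib mult_ac zero_le_mult_iff
        split: split_indicator)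
  also have "\<dots> = ennreal (c ^ Suc k) * (\<integral>\<^sup>+x. (ennreal (x ^ k * exp (- (x * c))) * indicator {0<..} x) \<partial>lborel)"
    using assms by (subst nn_integral_cmult) (auto simp: ennreal_mult mult_ac)
  finally have *: "ennreal (fact k) = ennreal (c ^ Suc k) * (\<integral>\<^sup>+x. (ennreal (x ^ k * exp (- (x * c))) * indicator {0<..} x) \<partial>lborel)" .
  have "ennreal (1 / c ^ Suc k) * ennreal (fact k) = (\<integral>\<^sup>+x. (ennreal (x ^ k * exp (- (x * c))) * indicator {0<..} x) \<partial>lborel)"
    using assms unfolding * mult.assoc[symmetric] by (simp add: ennreal_mult'[symmetric] field_simps del: power_Suc)
  then show ?thesis
    using assms by (simp add: ennreal_mult'[symmetric] del: power_Suc)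
qed

subsection \<open>Products of modified Bessel functions\<close>

text \<open>Half the integrand of \<open>bessel_K\<close>. That integrand is even in
  \<open>t\<close>, so \<open>kern\<close> is integrated over the whole line, where the variables
  can later be rotated.\<close>

definition kern :: "nat \<Rightarrow> real \<Rightarrow> real \<Rightarrow> real" where
  "kern n x t = exp (- (x * cosh t)) * cosh (real n * t) / 2"

lemma measurable_kern [measurable]:
  assumes [measurable]: "f \<in> borel_measurable M" "g \<in> borel_measurable M"
  shows "(\<lambda>z. kern n (f z) (g z)) \<in> borel_measurable M"
  unfolding kern_def by measurable

lemma kern_nonneg [simp]: "0 \<le> kern n x t"
  by (simp add: kern_def)

text \<open>A crude bound whose only purpose is finiteness: the quadratic Taylor bound for
  \<open>exp\<close> beats the factor \<open>cosh (real n * t)\<close>, which is at most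
  \<open>cosh t\<close> for \<open>n \<le> 1\<close>.\<close>

lemma kern_bound:
  assumes "n \<le> 1" "x > 0"
  shows "2 * kern n x t \<le> 4 / x\<^sup>2 * exp (- t)"
proof -
  have z: "0 < x * cosh t" using assms by simp
  have "1 + x * cosh t + (x * cosh t)\<^sup>2 / 2 \<le> exp (x * cosh t)"
    using exp_lower_Taylor_quadratic[of "x * cosh t"] z by simp
  then have "(x * cosh t)\<^sup>2 / 2 \<le> exp (x * cosh t)" using z by simp
  moreover have "0 < (x * cosh t)\<^sup>2" using z by (rule zero_less_power)
  ultimately have e: "exp (- (x * cosh t)) \<le> 2 / (x * cosh t)\<^sup>2"
    by (simp add: exp_minus field_simps del: zero_less_power2)
  have c: "cosh (real n * t) \<le> cosh t"
    using assms by (cases n) (auto simp: cosh_real_ge_1)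
  have "exp t / 2 \<le> cosh t" by (simp add: cosh_def)
  then have c2: "1 / cosh t \<le> 2 * exp (-t)"
    by (simp add: exp_minus field_simps)
  have "2 * kern n x t \<le> 2 / (x * cosh t)\<^sup>2 * cosh t"
    using mult_mono[OF e c] by (simp add: kern_def)
  also have "\<dots> = 2 / x\<^sup>2 * (1 / cosh t)"
    by (simp add: power2_eq_square field_simps)
  also have "\<dots> \<le> 2 / x\<^sup>2 * (2 * exp (-t))"
    by (intro mult_left_mono c2) auto
  finally show ?thesis by simp
qed

text \<open>Both sides default to 0 if the integral diverges, so \<open>x\<close> is unrestricted
  here.\<close>

lemma bessel_K_altdef: "bessel_K n x = enn2real (\<integral>\<^sup>+t. ennreal (kern n x t) \<partial>lborel)"
proof -
  have "bessel_K n x = (LINT t|lborel. indicator {0<..} t * (2 * kern n x t))"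
    unfolding bessel_K_def set_lebesgue_integral_def by (simp add: kern_def)
  also have "\<dots> = enn2real (\<integral>\<^sup>+t. ennreal (indicator {0<..} t * (2 * kern n x t)) \<partial>lborel)"
    by (intro integral_eq_nn_integral) auto
  also have "(\<integral>\<^sup>+t. ennreal (indicator {0<..} t * (2 * kern n x t)) \<partial>lborel)
     = (\<integral>\<^sup>+t. 2 * (ennreal (kern n x t) * indicator {0..} t) \<partial>lborel)"
    using AE_lborel_singleton[of "0::real"]
    by (intro nn_integral_cong_AE) (auto simp: ennreal_mult split: split_indicator)
  also have "\<dots> = (\<integral>\<^sup>+t. ennreal (kern n x t) \<partial>lborel)"
    by (subst nn_integral_cmult, simp, subst (2) nn_integral_even) (auto simp: kern_def)
  finally show ?thesis .
qed

lemma bessel_K_nonneg [simp]: "0 \<le> bessel_K n x"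
  by (simp add: bessel_K_altdef)

lemma measurable_bessel_K [measurable]:
  assumes [measurable]: "f \<in> borel_measurable M"
  shows "(\<lambda>x. bessel_K n (f x)) \<in> borel_measurable M"
  unfolding bessel_K_altdef by measurable

text \<open>Only finiteness has to be added to \<open>bessel_K_altdef\<close>;
  \<open>kern_bound\<close> provides an integrable exponential majorant.\<close>

lemma ennreal_bessel_K:
  assumes "n \<le> 1" "x > 0"
  shows "ennreal (bessel_K n x) = (\<integral>\<^sup>+t. ennreal (kern n x t) \<partial>lborel)"
proof -
  have "(\<integral>\<^sup>+t. ennreal (kern n x t) \<partial>lborel) = (\<integral>\<^sup>+t. ennreal (2 * kern n x t) * indicator {0..} t \<partial>lborel)"
    by (subst nn_integral_even, simp, simp add: kern_def, subst nn_integral_cmult[symmetric])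
      (auto simp: ennreal_mult mult_ac)
  also have "\<dots> \<le> (\<integral>\<^sup>+t. ennreal (4 / x\<^sup>2) * (ennreal (t ^ 0 * exp (- t)) * indicator {0..} t) \<partial>lborel)"
    using kern_bound[OF assms]
    by (intro nn_integral_mono) (auto simp: ennreal_mult'[symmetric] intro!: ennreal_leI split: split_indicator)
  also have "\<dots> = ennreal (4 / x\<^sup>2) * 1"
    by (subst nn_integral_cmult, simp) (subst nn_intergal_power_times_exp_Ici, simp)
  also have "\<dots> < \<infinity>" by simp
  finally show ?thesis
    by (simp add: bessel_K_altdef)
qed

text \<open>Valued in \<open>ennreal\<close>, so that Tonelli and additivity apply before finiteness
  is known.\<close>

definition bessel_KK :: "nat \<Rightarrow> nat \<Rightarrow> nat \<Rightarrow> real \<Rightarrow> real \<Rightarrow> ennreal" where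
  "bessel_KK p m n a b =
     (\<integral>\<^sup>+\<xi>. ennreal (\<xi> ^ p * bessel_K m (a * \<xi>) * bessel_K n (b * \<xi>)) * indicator {0<..} \<xi> \<partial>lborel)"

text \<open>Both Bessel functions are replaced by their kernels and Tonelli moves the integral over
  \<xi> inside, where it is a Gamma integral with rate
  \<open>a * cosh s + b * cosh t\<close>.\<close>

lemma bessel_KK_eq_double_integral:
  assumes "m \<le> 1" "n \<le> 1" "a > 0" "b > 0"
  shows "bessel_KK p m n a b = (\<integral>\<^sup>+s. \<integral>\<^sup>+t. ennreal (cosh (real m * s) * cosh (real n * t) *
           fact p / (4 * (a * cosh s + b * cosh t) ^ Suc p)) \<partial>lborel \<partial>lborel)"
proof -
  let ?f = "\<lambda>\<xi> s t. ennreal (\<xi> ^ p * kern m (a * \<xi>) s * kern n (b * \<xi>) t) * indicator {0<..} \<xi>"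
  have "ennreal (\<xi> ^ p * bessel_K m (a * \<xi>) * bessel_K n (b * \<xi>)) * indicator {0<..} \<xi> =
      (\<integral>\<^sup>+s. \<integral>\<^sup>+t. ?f \<xi> s t \<partial>lborel \<partial>lborel)" for \<xi> :: real
  proof (cases "\<xi> > 0")
    case True
    have "(\<integral>\<^sup>+s. \<integral>\<^sup>+t. ?f \<xi> s t \<partial>lborel \<partial>lborel)
       = (\<integral>\<^sup>+s. \<integral>\<^sup>+t. ennreal (\<xi> ^ p) * ennreal (kern m (a * \<xi>) s) * ennreal (kern n (b * \<xi>) t) \<partial>lborel \<partial>lborel)"
      using True by (intro nn_integral_cong) (simp add: ennreal_mult)
    also have "\<dots> = ennreal (\<xi> ^ p) * ennreal (bessel_K m (a * \<xi>)) * ennreal (bessel_K n (b * \<xi>))"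
      using assms True by (simp add: nn_integral_cmult nn_integral_multc ennreal_bessel_K)
    finally show ?thesis using True by (simp add: ennreal_mult)
  qed simp
  then have "bessel_KK p m n a b = (\<integral>\<^sup>+\<xi>. \<integral>\<^sup>+s. \<integral>\<^sup>+t. ?f \<xi> s t \<partial>lborel \<partial>lborel \<partial>lborel)"
    by (simp add: bessel_KK_def)
  also have "\<dots> = (\<integral>\<^sup>+s. \<integral>\<^sup>+\<xi>. \<integral>\<^sup>+t. ?f \<xi> s t \<partial>lborel \<partial>lborel \<partial>lborel)"
    by (rule lborel_pair.Fubini') measurable
  also have "\<dots> = (\<integral>\<^sup>+s. \<integral>\<^sup>+t. \<integral>\<^sup>+\<xi>. ?f \<xi> s t \<partial>lborel \<partial>lborel \<partial>lborel)"
    by (intro nn_integral_cong lborel_pair.Fubini') measurable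
  finally have *: "bessel_KK p m n a b = (\<integral>\<^sup>+s. \<integral>\<^sup>+t. \<integral>\<^sup>+\<xi>. ?f \<xi> s t \<partial>lborel \<partial>lborel \<partial>lborel)" .
  have inner: "(\<integral>\<^sup>+\<xi>. ?f \<xi> s t \<partial>lborel) = ennreal (cosh (real m * s) * cosh (real n * t) *
           fact p / (4 * (a * cosh s + b * cosh t) ^ Suc p))" for s t
  proof -
    let ?D = "a * cosh s + b * cosh t"
    have D: "?D > 0" using assms by (intro add_pos_pos mult_pos_pos) auto
    have "exp (- (a * \<xi> * cosh s)) * exp (- (b * \<xi> * cosh t)) = exp (- (\<xi> * ?D))" for \<xi>
      by (simp add: exp_add[symmetric] algebra_simps)
    then have kk: "\<xi> ^ p * kern m (a * \<xi>) s * kern n (b * \<xi>) t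
        = cosh (real m * s) * cosh (real n * t) / 4 * (\<xi> ^ p * exp (- (\<xi> * ?D)))" for \<xi>
      by (simp add: kern_def)
    have "(\<integral>\<^sup>+\<xi>. ?f \<xi> s t \<partial>lborel) = (\<integral>\<^sup>+\<xi>. ennreal (cosh (real m * s) * cosh (real n * t) / 4) *
        (ennreal (\<xi> ^ p * exp (- (\<xi> * ?D))) * indicator {0<..} \<xi>) \<partial>lborel)"
      by (intro nn_integral_cong)
        (simp only: kk, auto simp: ennreal_mult'[symmetric] split: split_indicator)
    also have "\<dots> = ennreal (cosh (real m * s) * cosh (real n * t) / 4) * ennreal (fact p / ?D ^ Suc p)"
      by (subst nn_integral_cmult, measurable, subst nn_integral_power_exp[OF D], simp)
    also have "\<dots> = ennreal (cosh (real m * s) * cosh (real n * t) * fact p / (4 * ?D ^ Suc p))"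
      by (subst ennreal_mult'[symmetric]) auto
    finally show ?thesis .
  qed
  show ?thesis unfolding * by (intro nn_integral_cong inner)
qed

text \<open>Rotating by 45 degrees factorises \<open>cosh s + cosh t = 2 * cosh u * cosh v\<close>, which separates
  the double integrals for \<open>a = b = 1\<close>.\<close>

lemma nn_integral_rotate:
  fixes f :: "real \<Rightarrow> real \<Rightarrow> ennreal"
  assumes [measurable]: "case_prod f \<in> borel_measurable (borel \<Otimes>\<^sub>M borel)"
  shows "(\<integral>\<^sup>+s. \<integral>\<^sup>+t. f s t \<partial>lborel \<partial>lborel) = 2 * (\<integral>\<^sup>+u. \<integral>\<^sup>+v. f (u + v) (u - v) \<partial>lborel \<partial>lborel)"
proof -
  have "(\<integral>\<^sup>+s. \<integral>\<^sup>+t. f s t \<partial>lborel \<partial>lborel) = (\<integral>\<^sup>+t. \<integral>\<^sup>+s. f s t \<partial>lborel \<partial>lborel)"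
    by (rule lborel_pair.Fubini'[symmetric]) measurable
  \<comment> \<open>The rotation is composed of one-variable substitutions:
    \<open>s = t + 2 * v\<close> for fixed \<open>t\<close>, which contributes the factor 2, and
    then \<open>t = u - v\<close> for fixed \<open>v\<close>.\<close>
  also have "\<dots> = (\<integral>\<^sup>+t. 2 * (\<integral>\<^sup>+v. f (t + 2 * v) t \<partial>lborel) \<partial>lborel)"
  proof (intro nn_integral_cong)
    fix t :: real
    have "(\<lambda>s. case_prod f (s, t)) \<in> borel_measurable borel" by measurable
    then show "(\<integral>\<^sup>+s. f s t \<partial>lborel) = 2 * (\<integral>\<^sup>+v. f (t + 2 * v) t \<partial>lborel)"
      by (subst nn_integral_real_affine[where c=2 and t=t]) auto
  qed
  also have "\<dots> = 2 * (\<integral>\<^sup>+t. (\<integral>\<^sup>+v. f (t + 2 * v) t \<partial>lborel) \<partial>lborel)"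
    by (intro nn_integral_cmult) measurable
  also have "(\<integral>\<^sup>+t. (\<integral>\<^sup>+v. f (t + 2 * v) t \<partial>lborel) \<partial>lborel) = (\<integral>\<^sup>+v. (\<integral>\<^sup>+t. f (t + 2 * v) t \<partial>lborel) \<partial>lborel)"
    by (rule lborel_pair.Fubini'[symmetric]) measurable
  also have "\<dots> = (\<integral>\<^sup>+v. (\<integral>\<^sup>+u. f (u + v) (u - v) \<partial>lborel) \<partial>lborel)"
  proof (rule nn_integral_cong)
    fix v :: real
    show "(\<integral>\<^sup>+t. f (t + 2 * v) t \<partial>lborel) = (\<integral>\<^sup>+u. f (u + v) (u - v) \<partial>lborel)"
      by (subst nn_integral_real_affine[where c=1 and t="-v"]) (measurable, auto simp: algebra_simps)
  qed
  also have "\<dots> = (\<integral>\<^sup>+u. \<integral>\<^sup>+v. f (u + v) (u - v) \<partial>lborel \<partial>lborel)"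
    by (rule lborel_pair.Fubini'[symmetric]) measurable
  finally show ?thesis .
qed

lemma cosh_add_plus_cosh_diff: "cosh (u + v) + cosh (u - v) = 2 * cosh u * cosh (v::real)"
  by (simp add: cosh_add cosh_diff)

lemma nn_integral_separate:
  fixes f g :: "real \<Rightarrow> real"
  assumes [measurable]: "f \<in> borel_measurable borel" "g \<in> borel_measurable borel"
    and "\<And>x. 0 \<le> f x" "\<And>x. 0 \<le> g x"
    and "(\<integral>\<^sup>+x. ennreal (f x) \<partial>lborel) = ennreal A" "(\<integral>\<^sup>+x. ennreal (g x) \<partial>lborel) = ennreal B"
    and "0 \<le> A" "0 \<le> B" "0 \<le> c"
  shows "(\<integral>\<^sup>+u. \<integral>\<^sup>+v. ennreal (c * f u * g v) \<partial>lborel \<partial>lborel) = ennreal (c * A * B)"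
  using assms by (simp add: ennreal_mult nn_integral_cmult nn_integral_multc)

lemma bessel_KK_1_0_0: "bessel_KK 1 0 0 1 1 = ennreal (1 / 2)"
proof -
  have "bessel_KK 1 0 0 1 1 = 2 * (\<integral>\<^sup>+u. \<integral>\<^sup>+v. ennreal (1 / (4 * (2 * cosh u * cosh v)\<^sup>2)) \<partial>lborel \<partial>lborel)"
    by (subst bessel_KK_eq_double_integral, simp_all, subst nn_integral_rotate, measurable)
      (simp add: cosh_add_plus_cosh_diff power2_eq_square)
  also have "\<dots> = 2 * (\<integral>\<^sup>+u. \<integral>\<^sup>+v. ennreal (1/16 * (1 / (cosh u)\<^sup>2) * (1 / (cosh v)\<^sup>2)) \<partial>lborel \<partial>lborel)"
    by (simp add: power_mult_distrib mult.assoc)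
  also have "(\<integral>\<^sup>+u. \<integral>\<^sup>+v. ennreal (1/16 * (1 / (cosh u)\<^sup>2) * (1 / (cosh v)\<^sup>2)) \<partial>lborel \<partial>lborel) = ennreal (1/16 * 2 * 2)"
    by (rule nn_integral_separate) (simp_all only: nn_integral_sech_square, auto)
  also have "2 * ennreal (1/16 * 2 * 2) = ennreal 2 * ennreal (1 / 4)" by simp
  also have "\<dots> = ennreal (1 / 2)" by (subst ennreal_mult'[symmetric]) auto
  finally show ?thesis .
qed

text \<open>After rotation this is a multiple of the square of the \<open>sech\<close> cube
  integral. The value is the reciprocal of the prefactor of \<open>F_ss\<close>, which makes
  \<open>F_ss 1 0 = 1\<close>.\<close>

lemma bessel_KK_2_0_0: "bessel_KK 2 0 0 1 1 = ennreal (pi\<^sup>2 / 32)"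
proof -
  have "bessel_KK 2 0 0 1 1 = 2 * (\<integral>\<^sup>+u. \<integral>\<^sup>+v. ennreal (2 / (4 * (2 * cosh u * cosh v)^3)) \<partial>lborel \<partial>lborel)"
    by (subst bessel_KK_eq_double_integral, simp_all, subst nn_integral_rotate, measurable)
      (simp add: cosh_add_plus_cosh_diff eval_nat_numeral)
  also have "\<dots> = 2 * (\<integral>\<^sup>+u. \<integral>\<^sup>+v. ennreal (1/16 * (1 / (cosh u)^3) * (1 / (cosh v)^3)) \<partial>lborel \<partial>lborel)"
    by (simp add: power_mult_distrib mult.assoc)
  also have "(\<integral>\<^sup>+u. \<integral>\<^sup>+v. ennreal (1/16 * (1 / (cosh u)^3) * (1 / (cosh v)^3)) \<partial>lborel \<partial>lborel)
      = ennreal (1/16 * (pi/2) * (pi/2))"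
    by (rule nn_integral_separate) (simp_all only: nn_integral_sech_cube, auto)
  also have "2 * ennreal (1/16 * (pi/2) * (pi/2)) = ennreal 2 * ennreal (1/16 * (pi/2) * (pi/2))" by simp
  also have "\<dots> = ennreal (pi\<^sup>2 / 32)" by (subst ennreal_mult'[symmetric]) (auto simp: power2_eq_square)
  finally show ?thesis .
qed

text \<open>The numerator \<open>cosh (u + v) * cosh (u - v)\<close> equals
  \<open>(cosh u)\<^sup>2 + (cosh v)\<^sup>2 - 1\<close>, so the rotated integrand is a combination
  of three separated terms. The value is the reciprocal of the prefactor of
  \<open>F_vv\<close>.\<close>

lemma bessel_KK_2_1_1: "bessel_KK 2 1 1 1 1 = ennreal (3 * pi\<^sup>2 / 32)"
proof -
  let ?f = "\<lambda>u v::real. 1/16 * (1 / cosh u) * (1 / cosh v ^ 3) :: real"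
  let ?h = "\<lambda>u v::real. 1/16 * (1 / cosh u ^ 3) * (1 / cosh v ^ 3) :: real"
  have c: "cosh (u + v) * cosh (u - v) = (cosh u)\<^sup>2 + (cosh v)\<^sup>2 - (1::real)" for u v
    using hyperbolic_pythagoras[of u] hyperbolic_pythagoras[of v]
    by (simp add: cosh_add cosh_diff) algebra
  have pw: "cosh (u + v) * cosh (u - v) * 2 / (4 * (2 * cosh u * cosh v)^3) = ?f u v + ?f v u - ?h u v" for u v :: real
  proof -
    have "((x\<^sup>2 + y\<^sup>2 - 1) * 2 / (4 * (2 * x * y)^3) = 1/16 * (1 / x) * (1 / y ^ 3) + 1/16 * (1 / y) * (1 / x ^ 3) - 1/16 * (1 / x ^ 3) * (1 / y ^ 3))"
      if "x > 0" "y > 0" for x y :: real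
      using that by (simp add: divide_simps) (simp add: power2_eq_square power3_eq_cube algebra_simps)
    then show ?thesis unfolding c by simp
  qed
  have "bessel_KK 2 1 1 1 1 = (\<integral>\<^sup>+s. \<integral>\<^sup>+t. ennreal (cosh s * cosh t * 2 / (4 * (cosh s + cosh t) ^ 3)) \<partial>lborel \<partial>lborel)"
    using bessel_KK_eq_double_integral[of 1 1 1 1 2] by (simp add: eval_nat_numeral)
  also have "\<dots> = 2 * (\<integral>\<^sup>+u. \<integral>\<^sup>+v. ennreal (cosh (u + v) * cosh (u - v) * 2 / (4 * (cosh (u + v) + cosh (u - v)) ^ 3)) \<partial>lborel \<partial>lborel)"
    by (rule nn_integral_rotate) measurable
  finally have "bessel_KK 2 1 1 1 1 = 2 * (\<integral>\<^sup>+u. \<integral>\<^sup>+v.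
      ennreal (cosh (u + v) * cosh (u - v) * 2 / (4 * (2 * cosh u * cosh v)^3)) \<partial>lborel \<partial>lborel)"
    by (simp only: cosh_add_plus_cosh_diff)
  note this[unfolded pw]
  then have 1: "bessel_KK 2 1 1 1 1 = 2 * (\<integral>\<^sup>+u. \<integral>\<^sup>+v. ennreal (?f u v + ?f v u - ?h u v) \<partial>lborel \<partial>lborel)" .
  have "?h u v \<le> ?f u v" for u v :: real
    by (intro mult_mono) (auto intro!: divide_left_mono self_le_power cosh_real_ge_1)
  then have le: "0 \<le> ?f u v + ?f v u - ?h u v" for u v :: real
    by (smt (verit) cosh_real_pos divide_nonneg_pos mult_nonneg_nonneg zero_less_power)
  have F: "(\<integral>\<^sup>+u. \<integral>\<^sup>+v. ennreal (?f u v) \<partial>lborel \<partial>lborel) = ennreal (1/16 * pi * (pi/2))"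
    by (rule nn_integral_separate) (simp_all only: nn_integral_sech nn_integral_sech_cube, auto)
  have H: "(\<integral>\<^sup>+u. \<integral>\<^sup>+v. ennreal (?h u v) \<partial>lborel \<partial>lborel) = ennreal (1/16 * (pi/2) * (pi/2))"
    by (rule nn_integral_separate) (simp_all only: nn_integral_sech_cube, auto)
  have F': "(\<integral>\<^sup>+u. \<integral>\<^sup>+v. ennreal (?f v u) \<partial>lborel \<partial>lborel) = ennreal (1/16 * pi * (pi/2))"
    unfolding F[symmetric] by (rule lborel_pair.Fubini') measurable
  \<comment> \<open>The term \<open>?h\<close> enters with a minus sign, so in
    \<open>ennreal\<close> it is added to both sides and its finite integral is cancelled
    afterwards.\<close>
  have "(\<integral>\<^sup>+u. \<integral>\<^sup>+v. ennreal (?f u v + ?f v u - ?h u v) \<partial>lborel \<partial>lborel)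
      + (\<integral>\<^sup>+u. \<integral>\<^sup>+v. ennreal (?h u v) \<partial>lborel \<partial>lborel)
     = (\<integral>\<^sup>+u. \<integral>\<^sup>+v. ennreal (?f u v + ?f v u - ?h u v) + ennreal (?h u v) \<partial>lborel \<partial>lborel)"
    by (simp add: nn_integral_add del: ennreal_plus)
  also have "\<dots> = (\<integral>\<^sup>+u. \<integral>\<^sup>+v. ennreal (?f u v) + ennreal (?f v u) \<partial>lborel \<partial>lborel)"
    by (intro nn_integral_cong, subst (1 2) ennreal_plus[symmetric]) (use le in auto)
  also have "\<dots> = (\<integral>\<^sup>+u. \<integral>\<^sup>+v. ennreal (?f u v) \<partial>lborel \<partial>lborel) + (\<integral>\<^sup>+u. \<integral>\<^sup>+v. ennreal (?f v u) \<partial>lborel \<partial>lborel)"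
    by (simp add: nn_integral_add)
  finally have "(\<integral>\<^sup>+u. \<integral>\<^sup>+v. ennreal (?f u v + ?f v u - ?h u v) \<partial>lborel \<partial>lborel) + ennreal (1/16 * (pi/2) * (pi/2))
    = ennreal (3 * pi\<^sup>2 / 64) + ennreal (1/16 * (pi/2) * (pi/2))"
    unfolding F F' H by (simp add: power2_eq_square flip: ennreal_plus)
  then have "(\<integral>\<^sup>+u. \<integral>\<^sup>+v. ennreal (?f u v + ?f v u - ?h u v) \<partial>lborel \<partial>lborel) = ennreal (3 * pi\<^sup>2 / 64)"
    by (simp only: add.commute[of _ "ennreal (1/16 * (pi/2) * (pi/2))"] ennreal_add_left_cancel) simp
  then have "bessel_KK 2 1 1 1 1 = ennreal 2 * ennreal (3 * pi\<^sup>2 / 64)"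
    unfolding 1 by simp
  also have "\<dots> = ennreal (3 * pi\<^sup>2 / 32)" by (subst ennreal_mult'[symmetric]) auto
  finally show ?thesis .
qed

section \<open>Scaling, the bound by equal scales, and linear relations for mixed products\<close>

lemma bessel_KK_commute: "bessel_KK p m n a b = bessel_KK p n m b a"
  by (simp add: bessel_KK_def mult_ac)

text \<open>Homogeneity of degree \<open>- Suc p\<close> in the scale, visible in the denominator of
  the double integral.\<close>

lemma bessel_KK_scale:
  assumes "m \<le> 1" "n \<le> 1" "a > 0"
  shows "ennreal (a ^ Suc p) * bessel_KK p m n a a = bessel_KK p m n 1 1"
proof -
  have "ennreal (a ^ Suc p) * bessel_KK p m n a a = (\<integral>\<^sup>+s. \<integral>\<^sup>+t. ennreal (a ^ Suc p) *
      ennreal (cosh (real m * s) * cosh (real n * t) * fact p / (4 * (a * cosh s + a * cosh t) ^ Suc p)) \<partial>lborel \<partial>lborel)"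
    using assms by (subst bessel_KK_eq_double_integral) (simp_all add: nn_integral_cmult del: power_Suc)
  also have "\<dots> = bessel_KK p m n 1 1"
  proof (subst bessel_KK_eq_double_integral; (intro nn_integral_cong)?)
    fix s t :: real
    have "a * cosh s + a * cosh t = a * (1 * cosh s + 1 * cosh t)" by (simp add: algebra_simps)
    then show "ennreal (a ^ Suc p) *
      ennreal (cosh (real m * s) * cosh (real n * t) * fact p / (4 * (a * cosh s + a * cosh t) ^ Suc p))
      = ennreal (cosh (real m * s) * cosh (real n * t) * fact p / (4 * (1 * cosh s + 1 * cosh t) ^ Suc p))"
      using assms by (simp only: power_mult_distrib) (simp add: ennreal_mult'[symmetric])
  qed (use assms in auto)
  finally show ?thesis .
qed

text \<open>AM-GM with weights \<open>a ^ Suc p\<close> and \<open>b ^ Suc p\<close>, whose product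
  is 1. By \<open>bessel_KK_scale\<close> these are exactly the weights for which each square
  integrates to the value at scale 1.\<close>

lemma bessel_KK_le_diagonal:
  assumes "m \<le> 1" "a > 0" "b > 0" "a * b = 1"
  shows "bessel_KK p m m a b \<le> bessel_KK p m m 1 1"
proof -
  let ?x = "\<lambda>c \<xi>. bessel_K m (c * \<xi>)"
  have "a ^ Suc p * b ^ Suc p = 1" using assms by (simp only: power_mult_distrib[symmetric]) simp
  then have am_gm: "x * y \<le> (a ^ Suc p * x * x + b ^ Suc p * y * y) / 2" for x y :: real
  proof -
    assume 1: "a ^ Suc p * b ^ Suc p = 1"
    define A B where "A = sqrt (a ^ Suc p)" and "B = sqrt (b ^ Suc p)"
    have AB: "A * B = 1" "A\<^sup>2 = a ^ Suc p" "B\<^sup>2 = b ^ Suc p"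
      unfolding A_def B_def using 1 assms by (simp_all only: real_sqrt_mult[symmetric]) simp_all
    have "0 \<le> (A * x - B * y)\<^sup>2" by simp
    also have "\<dots> = A\<^sup>2 * x * x + B\<^sup>2 * y * y - 2 * (A * B) * (x * y)"
      by (simp add: power2_eq_square algebra_simps)
    finally show ?thesis unfolding AB by simp
  qed
  have "bessel_KK p m m a b \<le> (\<integral>\<^sup>+\<xi>. ennreal (a ^ Suc p / 2) * (ennreal (\<xi> ^ p * ?x a \<xi> * ?x a \<xi>) * indicator {0<..} \<xi>)
     + ennreal (b ^ Suc p / 2) * (ennreal (\<xi> ^ p * ?x b \<xi> * ?x b \<xi>) * indicator {0<..} \<xi>) \<partial>lborel)"
    unfolding bessel_KK_def
  proof (intro nn_integral_mono)
    fix \<xi> :: real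
    show "ennreal (\<xi> ^ p * ?x a \<xi> * ?x b \<xi>) * indicator {0<..} \<xi> \<le>
      ennreal (a ^ Suc p / 2) * (ennreal (\<xi> ^ p * ?x a \<xi> * ?x a \<xi>) * indicator {0<..} \<xi>)
     + ennreal (b ^ Suc p / 2) * (ennreal (\<xi> ^ p * ?x b \<xi> * ?x b \<xi>) * indicator {0<..} \<xi>)"
    proof (cases "\<xi> > 0")
      case True
      have "\<xi> ^ p * ?x a \<xi> * ?x b \<xi> \<le> \<xi> ^ p * ((a ^ Suc p * ?x a \<xi> * ?x a \<xi> + b ^ Suc p * ?x b \<xi> * ?x b \<xi>) / 2)"
        using am_gm[of "?x a \<xi>" "?x b \<xi>"] True by (simp only: mult.assoc) (intro mult_left_mono, auto)
      then have "ennreal (\<xi> ^ p * ?x a \<xi> * ?x b \<xi>) \<le> ennreal (a ^ Suc p / 2 * (\<xi> ^ p * ?x a \<xi> * ?x a \<xi>) + b ^ Suc p / 2 * (\<xi> ^ p * ?x b \<xi> * ?x b \<xi>))"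
        by (intro ennreal_leI) (simp add: algebra_simps add_divide_distrib)
      also have "\<dots> = ennreal (a ^ Suc p / 2) * ennreal (\<xi> ^ p * ?x a \<xi> * ?x a \<xi>) + ennreal (b ^ Suc p / 2) * ennreal (\<xi> ^ p * ?x b \<xi> * ?x b \<xi>)"
        using assms True by (subst (1 2) ennreal_mult[symmetric], simp_all del: power_Suc ennreal_plus)
          (subst ennreal_plus[symmetric], simp_all del: power_Suc ennreal_plus)
      finally show ?thesis using True by simp
    qed simp
  qed
  also have "\<dots> = ennreal (a ^ Suc p / 2) * bessel_KK p m m a a + ennreal (b ^ Suc p / 2) * bessel_KK p m m b b"
    unfolding bessel_KK_def by (simp add: nn_integral_add nn_integral_cmult)
  also have "\<dots> = ennreal (1 / 2) * (ennreal (a ^ Suc p) * bessel_KK p m m a a) + ennreal (1 / 2) * (ennreal (b ^ Suc p) * bessel_KK p m m b b)"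
    unfolding mult.assoc[symmetric] by (subst (1 2) ennreal_mult'[symmetric]) (simp_all add: assms)
  also have "\<dots> = ennreal (1 / 2) * bessel_KK p m m 1 1 + ennreal (1 / 2) * bessel_KK p m m 1 1"
    using assms by (simp only: bessel_KK_scale)
  also have "\<dots> = (ennreal (1 / 2) + ennreal (1 / 2)) * bessel_KK p m m 1 1"
    by (simp only: distrib_right)
  also have "ennreal (1 / 2) + ennreal (1 / 2) = 1"
    by (subst ennreal_plus[symmetric]) auto
  finally show ?thesis by simp
qed

text \<open>In the double integral the weighted numerators add up to
  \<open>a * cosh s + b * cosh t\<close>, which cancels one power of the cubed denominator and
  leaves the integrand for \<open>p = 1\<close>.\<close>

lemma bessel_KK_sum_1:
  assumes "a > 0" "b > 0"
  shows "ennreal a * bessel_KK 2 1 0 a b + ennreal b * bessel_KK 2 0 1 a b = 2 * bessel_KK 1 0 0 a b"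
proof -
  let ?D = "\<lambda>s t. a * cosh s + b * cosh t"
  have "ennreal a * bessel_KK 2 1 0 a b + ennreal b * bessel_KK 2 0 1 a b =
    (\<integral>\<^sup>+s. \<integral>\<^sup>+t. ennreal a * ennreal (cosh s * 2 / (4 * ?D s t ^ 3)) + ennreal b * ennreal (cosh t * 2 / (4 * ?D s t ^ 3)) \<partial>lborel \<partial>lborel)"
    using assms bessel_KK_eq_double_integral[of 1 0 a b 2] bessel_KK_eq_double_integral[of 0 1 a b 2]
    by (simp add: nn_integral_add nn_integral_cmult eval_nat_numeral)
  also have "\<dots> = (\<integral>\<^sup>+s. \<integral>\<^sup>+t. ennreal 2 * ennreal (1 / (4 * ?D s t ^ 2)) \<partial>lborel \<partial>lborel)"
  proof (intro nn_integral_cong)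
    fix s t :: real
    have D: "?D s t > 0" using assms by (intro add_pos_pos mult_pos_pos) auto
    have "ennreal a * ennreal (cosh s * 2 / (4 * ?D s t ^ 3)) + ennreal b * ennreal (cosh t * 2 / (4 * ?D s t ^ 3))
      = ennreal (a * (cosh s * 2 / (4 * ?D s t ^ 3)) + b * (cosh t * 2 / (4 * ?D s t ^ 3)))"
      using assms D by (subst (1 2) ennreal_mult'[symmetric], simp, simp) (subst ennreal_plus, auto)
    also have "a * (cosh s * 2 / (4 * ?D s t ^ 3)) + b * (cosh t * 2 / (4 * ?D s t ^ 3)) = ?D s t * 2 / (4 * ?D s t ^ 3)"
      by (simp add: algebra_simps add_divide_distrib)
    also have "\<dots> = 2 * (1 / (4 * ?D s t ^ 2))"
    proof -
      have "d * 2 / (4 * d ^ 3) = 2 * (1 / (4 * d\<^sup>2))" if "d > 0" for d :: real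
        using that by (simp add: power2_eq_square power3_eq_cube)
      from this[OF D] show ?thesis .
    qed
    also have "ennreal \<dots> = ennreal 2 * ennreal (1 / (4 * ?D s t ^ 2))"
      by (rule ennreal_mult') simp
    finally show "ennreal a * ennreal (cosh s * 2 / (4 * ?D s t ^ 3)) + ennreal b * ennreal (cosh t * 2 / (4 * ?D s t ^ 3))
      = ennreal 2 * ennreal (1 / (4 * ?D s t ^ 2))" .
  qed
  also have "\<dots> = 2 * bessel_KK 1 0 0 a b"
    using assms by (subst bessel_KK_eq_double_integral) (simp_all add: nn_integral_cmult power2_eq_square)
  finally show ?thesis .
qed

text \<open>The difference of the integrands is the derivative of
  \<open>tanh t * exp (- (x * cosh t))\<close>, which vanishes at both infinities. The left side
  arises by integrating \<open>y * kern 0 y t\<close> over \<open>y \<ge> x\<close>, the right side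
  from \<open>x * kern 1 x t\<close>.\<close>

lemma nn_integral_kern_by_parts:
  assumes "x > 0"
  shows "(\<integral>\<^sup>+t. ennreal ((x / cosh t + 1 / (cosh t)\<^sup>2) * exp (- (x * cosh t))) \<partial>lborel)
       = (\<integral>\<^sup>+t. ennreal (x * cosh t * exp (- (x * cosh t))) \<partial>lborel)"
    (is "integral\<^sup>N _ (\<lambda>t. ennreal (?g t)) = integral\<^sup>N _ (\<lambda>t. ennreal (?f t))")
proof -
  \<comment> \<open>The integrand \<open>?f - ?g\<close> changes sign; adding \<open>1 / (cosh t)\<^sup>2\<close> gives the
    nonnegative derivative of \<open>tanh t * (1 - exp (- (x * cosh t)))\<close>.\<close>
  define q where "q t = 1 / (cosh t)\<^sup>2 + ?f t - ?g t" for t :: real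
  have q_eq: "q t = (1 / (cosh t)\<^sup>2) * (1 - exp (- (x * cosh t))) + x * (cosh t - 1 / cosh t) * exp (- (x * cosh t))" for t
    by (simp add: q_def algebra_simps diff_divide_distrib)
  have q_nonneg: "0 \<le> q t" for t
  proof -
    have "1 / cosh t \<le> 1" using cosh_real_ge_1[of t] by simp
    then have "1 / cosh t \<le> cosh t" using cosh_real_ge_1[of t] by linarith
    then show ?thesis unfolding q_eq using assms by (intro add_nonneg_nonneg mult_nonneg_nonneg) auto
  qed
  let ?F = "\<lambda>t. tanh t * (1 - exp (- (x * cosh t)))"
  have [measurable]: "q \<in> borel_measurable borel" unfolding q_def by measurable
  have "(\<integral>\<^sup>+t. ennreal (q t) \<partial>lborel) = ennreal (2 * 1)"
  proof (rule nn_integral_real_even[where F="?F"])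
    show "DERIV ?F t :> q t" for t
    proof -
      have "DERIV ?F t :> (1 - (tanh t)\<^sup>2) * (1 - exp (- (x * cosh t))) + tanh t * (x * sinh t * exp (- (x * cosh t)))"
        by (auto intro!: derivative_eq_intros)
      also have "1 - (tanh t)\<^sup>2 = ((cosh t)\<^sup>2 - (sinh t)\<^sup>2) / (cosh t)\<^sup>2"
        by (simp add: tanh_def power_divide diff_divide_distrib)
      also have "\<dots> = 1 / (cosh t)\<^sup>2" by (simp only: hyperbolic_pythagoras)
      also have "tanh t * (x * sinh t * exp (- (x * cosh t))) = x * ((sinh t)\<^sup>2 / cosh t) * exp (- (x * cosh t))"
        by (simp add: tanh_def power2_eq_square)
      also have "(sinh t)\<^sup>2 = (cosh t)\<^sup>2 - 1" using hyperbolic_pythagoras[of t] by simp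
      also have "((cosh t)\<^sup>2 - 1) / cosh t = cosh t - 1 / cosh t"
        by (simp add: power2_eq_square field_simps)
      finally show ?thesis unfolding q_eq .
    qed
    have "((\<lambda>t. exp (- (x * cosh t))) \<longlongrightarrow> 0) at_top" using assms by real_asymp
    then have "(?F \<longlongrightarrow> 1 * (1 - 0)) at_top"
      by (intro tendsto_intros tanh_real_at_top)
    then show "(?F \<longlongrightarrow> 1) at_top" by simp
  qed (use q_nonneg in \<open>auto simp: q_def\<close>)
  then have *: "(\<integral>\<^sup>+t. ennreal (q t) \<partial>lborel) = ennreal 2" by simp
  have "ennreal 2 + (\<integral>\<^sup>+t. ennreal (?g t) \<partial>lborel) = (\<integral>\<^sup>+t. ennreal (q t) + ennreal (?g t) \<partial>lborel)"
    unfolding *[symmetric] by (rule nn_integral_add[symmetric]) auto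
  also have "\<dots> = (\<integral>\<^sup>+t. ennreal (1 / (cosh t)\<^sup>2) + ennreal (?f t) \<partial>lborel)"
  proof (intro nn_integral_cong)
    fix t :: real
    have "0 \<le> ?g t" "0 \<le> ?f t" using assms by (auto intro!: mult_nonneg_nonneg add_nonneg_nonneg)
    then show "ennreal (q t) + ennreal (?g t) = ennreal (1 / (cosh t)\<^sup>2) + ennreal (?f t)"
      using q_nonneg[of t] by (simp add: ennreal_plus[symmetric] q_def del: ennreal_plus)
  qed
  also have "\<dots> = ennreal 2 + (\<integral>\<^sup>+t. ennreal (?f t) \<partial>lborel)"
    unfolding nn_integral_sech_square[symmetric] by (rule nn_integral_add) auto
  finally show ?thesis by (simp only: ennreal_add_left_cancel) simp
qed

text \<open>The integrated form of the relation that \<open>x * bessel_K 1 x\<close> has derivative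
  \<open>- x * bessel_K 0 x\<close>. It is obtained from the kernels by Tonelli and
  \<open>nn_integral_kern_by_parts\<close>.\<close>

lemma nn_integral_tail_bessel_K0:
  assumes "x > 0"
  shows "(\<integral>\<^sup>+y. ennreal (y * bessel_K 0 y) * indicator {x..} y \<partial>lborel) = ennreal (x * bessel_K 1 x)"
proof -
  have "(\<integral>\<^sup>+y. ennreal (y * bessel_K 0 y) * indicator {x..} y \<partial>lborel)
    = (\<integral>\<^sup>+y. \<integral>\<^sup>+t. ennreal (y * kern 0 y t) * indicator {x..} y \<partial>lborel \<partial>lborel)"
  proof (intro nn_integral_cong)
    fix y :: real
    show "ennreal (y * bessel_K 0 y) * indicator {x..} y = (\<integral>\<^sup>+t. ennreal (y * kern 0 y t) * indicator {x..} y \<partial>lborel)"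
    proof (cases "y \<ge> x")
      case True
      then show ?thesis using assms
        by (simp add: ennreal_mult nn_integral_cmult ennreal_bessel_K)
    qed simp
  qed
  also have "\<dots> = (\<integral>\<^sup>+t. \<integral>\<^sup>+y. ennreal (y * kern 0 y t) * indicator {x..} y \<partial>lborel \<partial>lborel)"
    by (rule lborel_pair.Fubini') measurable
  also have "\<dots> = (\<integral>\<^sup>+t. ennreal (1 / 2) * ennreal ((x / cosh t + 1 / (cosh t)\<^sup>2) * exp (- (x * cosh t))) \<partial>lborel)"
  proof (intro nn_integral_cong)
    fix t :: real
    let ?c = "cosh t"
    let ?F = "\<lambda>y. - ((y / ?c + 1 / ?c\<^sup>2) * exp (- (y * ?c))) / 2"
    have "(\<integral>\<^sup>+y. ennreal (y * kern 0 y t) * indicator {x..} y \<partial>lborel) = ennreal (0 - ?F x)"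
    proof (rule nn_integral_FTC_atLeast)
      show "(\<lambda>y. y * kern 0 y t) \<in> borel_measurable borel" by measurable
      show "DERIV ?F y :> y * kern 0 y t" if "x \<le> y" for y
        unfolding kern_def
        by (auto intro!: derivative_eq_intros simp: power2_eq_square field_simps)
      show "0 \<le> y * kern 0 y t" if "x \<le> y" for y
        using assms that by auto
      have "((\<lambda>y. - ((y / c + 1 / c\<^sup>2) * exp (- (y * c))) / 2) \<longlongrightarrow> 0) at_top" if "c > 0" for c :: real
        using that by real_asymp
      then show "(?F \<longlongrightarrow> 0) at_top" by simp
    qed
    also have "0 - ?F x = 1 / 2 * ((x / ?c + 1 / ?c\<^sup>2) * exp (- (x * ?c)))" by simp
    finally show "(\<integral>\<^sup>+y. ennreal (y * kern 0 y t) * indicator {x..} y \<partial>lborel)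
      = ennreal (1 / 2) * ennreal ((x / ?c + 1 / ?c\<^sup>2) * exp (- (x * ?c)))"
      by (simp only: ennreal_mult')
  qed
  also have "\<dots> = ennreal (1 / 2) * (\<integral>\<^sup>+t. ennreal (x * cosh t * exp (- (x * cosh t))) \<partial>lborel)"
    by (subst nn_integral_cmult, measurable) (simp only: nn_integral_kern_by_parts[OF assms])
  also have "\<dots> = (\<integral>\<^sup>+t. ennreal (1 / 2) * ennreal (x * cosh t * exp (- (x * cosh t))) \<partial>lborel)"
    by (rule nn_integral_cmult[symmetric]) measurable
  also have "\<dots> = (\<integral>\<^sup>+t. ennreal x * ennreal (kern 1 x t) \<partial>lborel)"
    using assms by (subst (1 2) ennreal_mult'[symmetric]) (simp_all add: kern_def mult_ac)
  also have "\<dots> = ennreal (x * bessel_K 1 x)"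
    using assms by (simp add: nn_integral_cmult ennreal_bessel_K ennreal_mult)
  finally show ?thesis .
qed

text \<open>A probability density on the positive half-line whose tail function is
  \<open>a * x * bessel_K 1 (a * x)\<close>. Of two points drawn from the densities for \<open>a\<close> and \<open>b\<close>,
  one is the larger almost surely; this yields \<open>bessel_KK_sum_2\<close> without differentiation.\<close>

definition K0_density :: "real \<Rightarrow> real \<Rightarrow> ennreal" where
  "K0_density a \<xi> = ennreal (a\<^sup>2 * \<xi> * bessel_K 0 (a * \<xi>)) * indicator {0<..} \<xi>"

lemma measurable_K0_density [measurable]: "K0_density a \<in> borel_measurable borel"
  unfolding K0_density_def by measurable

lemma nn_integral_tail_K0_density:
  assumes "a > 0" "x > 0"
  shows "(\<integral>\<^sup>+y. K0_density a y * indicator {x..} y \<partial>lborel) = ennreal (a * x * bessel_K 1 (a * x))"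
proof -
  have "ennreal (a * x * bessel_K 1 (a * x)) = (\<integral>\<^sup>+y. ennreal (y * bessel_K 0 y) * indicator {a * x..} y \<partial>lborel)"
    using assms by (simp add: nn_integral_tail_bessel_K0)
  also have "\<dots> = ennreal a * (\<integral>\<^sup>+y. ennreal (a * y * bessel_K 0 (a * y)) * indicator {a * x..} (a * y) \<partial>lborel)"
    using assms by (subst nn_integral_real_affine[where c=a and t=0]) auto
  also have "\<dots> = (\<integral>\<^sup>+y. K0_density a y * indicator {x..} y \<partial>lborel)"
    unfolding K0_density_def using assms
    by (subst nn_integral_cmult[symmetric], measurable)
      (auto intro!: nn_integral_cong simp: ennreal_mult'[symmetric] power2_eq_square mult_ac split: split_indicator)
  finally show ?thesis ..
qed

text \<open>The tail formula covers only \<open>x > 0\<close>; instead of a limit in it, the total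
  mass is computed from the kernels and reduces to the \<open>sech\<close> square integral.\<close>

lemma nn_integral_K0_density:
  assumes "a > 0"
  shows "(\<integral>\<^sup>+\<xi>. K0_density a \<xi> \<partial>lborel) = 1"
proof -
  have "(\<integral>\<^sup>+\<xi>. K0_density a \<xi> \<partial>lborel) = (\<integral>\<^sup>+\<xi>. \<integral>\<^sup>+t. ennreal (a\<^sup>2 * \<xi> * kern 0 (a * \<xi>) t) * indicator {0<..} \<xi> \<partial>lborel \<partial>lborel)"
  proof (intro nn_integral_cong)
    fix \<xi> :: real
    show "K0_density a \<xi> = (\<integral>\<^sup>+t. ennreal (a\<^sup>2 * \<xi> * kern 0 (a * \<xi>) t) * indicator {0<..} \<xi> \<partial>lborel)"
    proof (cases "\<xi> > 0")
      case True
      then show ?thesis using assms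
        by (simp add: K0_density_def ennreal_mult nn_integral_cmult ennreal_bessel_K)
    qed (simp add: K0_density_def)
  qed
  also have "\<dots> = (\<integral>\<^sup>+t. \<integral>\<^sup>+\<xi>. ennreal (a\<^sup>2 * \<xi> * kern 0 (a * \<xi>) t) * indicator {0<..} \<xi> \<partial>lborel \<partial>lborel)"
    by (rule lborel_pair.Fubini') measurable
  also have "\<dots> = (\<integral>\<^sup>+t. ennreal (1 / 2) * ennreal (1 / (cosh t)\<^sup>2) \<partial>lborel)"
  proof (intro nn_integral_cong)
    fix t :: real
    have c: "a * cosh t > 0" using assms by simp
    have "(\<integral>\<^sup>+\<xi>. ennreal (a\<^sup>2 * \<xi> * kern 0 (a * \<xi>) t) * indicator {0<..} \<xi> \<partial>lborel)
      = (\<integral>\<^sup>+\<xi>. ennreal (a\<^sup>2 / 2) * (ennreal (\<xi> ^ 1 * exp (- (\<xi> * (a * cosh t)))) * indicator {0<..} \<xi>) \<partial>lborel)"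
      by (auto intro!: nn_integral_cong simp: kern_def ennreal_mult'[symmetric] mult_ac split: split_indicator)
    also have "\<dots> = ennreal (a\<^sup>2 / 2) * ennreal (fact 1 / (a * cosh t) ^ Suc 1)"
      by (subst nn_integral_cmult, measurable, subst nn_integral_power_exp[OF c], simp)
    also have "\<dots> = ennreal (1 / 2 * (1 / (cosh t)\<^sup>2))"
      using assms by (subst ennreal_mult'[symmetric]) (simp_all add: power2_eq_square)
    also have "\<dots> = ennreal (1 / 2) * ennreal (1 / (cosh t)\<^sup>2)"
      by (rule ennreal_mult') simp
    finally show "(\<integral>\<^sup>+\<xi>. ennreal (a\<^sup>2 * \<xi> * kern 0 (a * \<xi>) t) * indicator {0<..} \<xi> \<partial>lborel)
      = ennreal (1 / 2) * ennreal (1 / (cosh t)\<^sup>2)" .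
  qed
  also have "\<dots> = ennreal (1 / 2) * ennreal 2"
    by (subst nn_integral_cmult, measurable) (simp only: nn_integral_sech_square)
  also have "\<dots> = 1" by (subst ennreal_mult'[symmetric]) auto
  finally show ?thesis .
qed

lemma bessel_KK_sum_2:
  assumes "a > 0" "b > 0" "a * b = 1"
  shows "ennreal a * bessel_KK 2 0 1 a b + ennreal b * bessel_KK 2 1 0 a b = 1"
proof -
  \<comment> \<open>Because \<open>c * d = 1\<close>, the integrand is the density for
    \<open>c\<close> times the tail for \<open>d\<close>. The left side is thus the probability that
    the point drawn for \<open>c\<close> does not exceed the one drawn for \<open>d\<close>.\<close>
  have *: "ennreal c * bessel_KK 2 0 1 c d = (\<integral>\<^sup>+\<xi>. \<integral>\<^sup>+y. K0_density c \<xi> * (K0_density d y * of_bool (\<xi> \<le> y)) \<partial>lborel \<partial>lborel)"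
    if "c > 0" "d > 0" "c * d = 1" for c d
  proof -
    have "ennreal c * bessel_KK 2 0 1 c d = (\<integral>\<^sup>+\<xi>. K0_density c \<xi> * ennreal (d * \<xi> * bessel_K 1 (d * \<xi>)) \<partial>lborel)"
      unfolding bessel_KK_def K0_density_def
    proof (subst nn_integral_cmult[symmetric], measurable, intro nn_integral_cong)
      fix \<xi> :: real
      have "c\<^sup>2 * \<xi> * k * (d * \<xi> * l) = (c * d) * (c * (\<xi>\<^sup>2 * k * l))" for k l
        by (simp add: power2_eq_square)
      then have "c\<^sup>2 * \<xi> * bessel_K 0 (c * \<xi>) * (d * \<xi> * bessel_K 1 (d * \<xi>)) = c * (\<xi>\<^sup>2 * bessel_K 0 (c * \<xi>) * bessel_K 1 (d * \<xi>))"
        using that by simp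
      then show "ennreal c * (ennreal (\<xi>\<^sup>2 * bessel_K 0 (c * \<xi>) * bessel_K 1 (d * \<xi>)) * indicator {0<..} \<xi>) =
         ennreal (c\<^sup>2 * \<xi> * bessel_K 0 (c * \<xi>)) * indicator {0<..} \<xi> * ennreal (d * \<xi> * bessel_K 1 (d * \<xi>))"
        using that by (auto simp: ennreal_mult'[symmetric] split: split_indicator)
    qed
    also have "\<dots> = (\<integral>\<^sup>+\<xi>. K0_density c \<xi> * (\<integral>\<^sup>+y. K0_density d y * indicator {\<xi>..} y \<partial>lborel) \<partial>lborel)"
    proof (intro nn_integral_cong)
      fix \<xi> :: real
      show "K0_density c \<xi> * ennreal (d * \<xi> * bessel_K 1 (d * \<xi>)) = K0_density c \<xi> * (\<integral>\<^sup>+y. K0_density d y * indicator {\<xi>..} y \<partial>lborel)"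
      proof (cases "\<xi> > 0")
        case True
        then show ?thesis using that by (simp add: nn_integral_tail_K0_density)
      qed (simp add: K0_density_def)
    qed
    also have "\<dots> = (\<integral>\<^sup>+\<xi>. \<integral>\<^sup>+y. K0_density c \<xi> * (K0_density d y * of_bool (\<xi> \<le> y)) \<partial>lborel \<partial>lborel)"
      by (subst nn_integral_cmult[symmetric]) (auto intro!: nn_integral_cong simp: indicator_def of_bool_def)
    finally show ?thesis .
  qed
  let ?f = "K0_density a" and ?g = "K0_density b"
  have "ennreal b * bessel_KK 2 1 0 a b = (\<integral>\<^sup>+y. \<integral>\<^sup>+\<xi>. ?g y * (?f \<xi> * of_bool (y \<le> \<xi>)) \<partial>lborel \<partial>lborel)"
  proof -
    have "b * a = 1" using assms(3) by (simp only: mult.commute)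
    from *[OF assms(2,1) this] show ?thesis by (subst bessel_KK_commute)
  qed
  also have "\<dots> = (\<integral>\<^sup>+\<xi>. \<integral>\<^sup>+y. ?g y * (?f \<xi> * of_bool (y \<le> \<xi>)) \<partial>lborel \<partial>lborel)"
    by (rule lborel_pair.Fubini'[symmetric]) measurable
  finally have "ennreal a * bessel_KK 2 0 1 a b + ennreal b * bessel_KK 2 1 0 a b =
     (\<integral>\<^sup>+\<xi>. \<integral>\<^sup>+y. ?f \<xi> * (?g y * of_bool (\<xi> \<le> y)) \<partial>lborel \<partial>lborel) + (\<integral>\<^sup>+\<xi>. \<integral>\<^sup>+y. ?g y * (?f \<xi> * of_bool (y \<le> \<xi>)) \<partial>lborel \<partial>lborel)"
    using *[OF assms] by (simp only:)
  also have "\<dots> = (\<integral>\<^sup>+\<xi>. \<integral>\<^sup>+y. ?f \<xi> * (?g y * of_bool (\<xi> \<le> y)) + ?g y * (?f \<xi> * of_bool (y \<le> \<xi>)) \<partial>lborel \<partial>lborel)"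
    by (subst nn_integral_add[symmetric], measurable, intro nn_integral_cong nn_integral_add[symmetric]) measurable
  \<comment> \<open>The two orderings cover all pairs and overlap only on the diagonal, a null set
    in \<open>y\<close> for each \<xi>.\<close>
  also have "\<dots> = (\<integral>\<^sup>+\<xi>. \<integral>\<^sup>+y. ?f \<xi> * ?g y \<partial>lborel \<partial>lborel)"
  proof (rule nn_integral_cong, rule nn_integral_cong_AE)
    fix \<xi> :: real
    show "AE y in lborel. ?f \<xi> * (?g y * of_bool (\<xi> \<le> y)) + ?g y * (?f \<xi> * of_bool (y \<le> \<xi>)) = ?f \<xi> * ?g y"
      using AE_lborel_singleton[of \<xi>] by eventually_elim (auto simp: mult.commute simp: not_le)
  qed
  also have "\<dots> = (\<integral>\<^sup>+\<xi>. ?f \<xi> * 1 \<partial>lborel)"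
    unfolding nn_integral_K0_density[OF assms(2), symmetric] by (intro nn_integral_cong nn_integral_cmult) measurable
  also have "\<dots> = 1"
    using nn_integral_K0_density[OF assms(1)] by simp
  finally show ?thesis .
qed

text \<open>At equal scales the two terms of \<open>bessel_KK_sum_2\<close> coincide by symmetry, so
  each is half of the total.\<close>

lemma bessel_KK_2_0_1: "bessel_KK 2 0 1 1 1 = ennreal (1 / 2)"
proof -
  have "bessel_KK 2 0 1 1 1 + bessel_KK 2 0 1 1 1 = 1"
    using bessel_KK_sum_2[of 1 1] bessel_KK_commute[of 2 1 0 1 1] by simp
  then have 2: "2 * bessel_KK 2 0 1 1 1 = 1" by (simp add: mult_2)
  then have "bessel_KK 2 0 1 1 1 \<noteq> top" by auto
  then obtain r where r: "bessel_KK 2 0 1 1 1 = ennreal r" "r \<ge> 0"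
    by (cases "bessel_KK 2 0 1 1 1") auto
  have "ennreal (2 * r) = ennreal 1" using 2 r by (simp add: ennreal_mult)
  then have "r = 1 / 2" using r by (subst (asm) ennreal_inj) auto
  then show ?thesis using r(1) by (simp only:)
qed

text \<open>Adding the two linear relations gives \<open>(a + b) * (P + Q) = 1 + 2 * I\<close>, at
  most 2 by the diagonal bound, while \<open>a * b = 1\<close> forces
  \<open>a + b \<ge> 2\<close>.\<close>

lemma bessel_KK_2_0_1_plus_2_1_0_le:
  assumes "a > 0" "b > 0" "a * b = 1"
  shows "bessel_KK 2 0 1 a b + bessel_KK 2 1 0 a b \<le> 1"
proof -
  let ?P = "bessel_KK 2 0 1 a b" and ?Q = "bessel_KK 2 1 0 a b"
  have "bessel_KK 1 0 0 a b \<le> ennreal (1 / 2)"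
    using bessel_KK_le_diagonal[of 0 a b 1] assms unfolding bessel_KK_1_0_0 by simp
  then have "2 * bessel_KK 1 0 0 a b \<le> ennreal 2 * ennreal (1 / 2)"
    by (simp add: mult_left_mono)
  also have "\<dots> = 1" by (subst ennreal_mult'[symmetric]) auto
  finally have I: "2 * bessel_KK 1 0 0 a b \<le> 1" .
  have ab: "ennreal (a + b) = ennreal a + ennreal b" using assms by (intro ennreal_plus) auto
  have "ennreal (a + b) * (?P + ?Q) = (ennreal a * ?P + ennreal b * ?Q) + (ennreal a * ?Q + ennreal b * ?P)"
    unfolding ab by (simp add: distrib_left distrib_right add_ac)
  also have "\<dots> = 1 + 2 * bessel_KK 1 0 0 a b"
    by (simp only: bessel_KK_sum_1[OF assms(1,2)] bessel_KK_sum_2[OF assms])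
  also have "\<dots> \<le> 1 + 1" using I by (intro add_left_mono)
  finally have 1: "ennreal (a + b) * (?P + ?Q) \<le> ennreal 2" by simp
  have "0 \<le> (a - b)\<^sup>2" by simp
  then have "2\<^sup>2 \<le> (a + b)\<^sup>2" using assms(3) by (simp add: power2_eq_square algebra_simps)
  then have "2 \<le> a + b" by (rule power2_le_imp_le) (use assms in linarith)
  then have "ennreal 2 * (?P + ?Q) \<le> ennreal (a + b) * (?P + ?Q)"
    by (intro mult_right_mono ennreal_leI) auto
  with 1 have "ennreal 2 * (?P + ?Q) \<le> ennreal 2 * 1" by simp
  then have "ennreal (1/2) * (ennreal 2 * (?P + ?Q)) \<le> ennreal (1/2) * (ennreal 2 * 1)"
    by (rule mult_left_mono) simp
  moreover have "ennreal (1/2) * ennreal 2 = 1" by (subst ennreal_mult'[symmetric]) auto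
  ultimately show ?thesis by (simp only: mult.assoc[symmetric]) simp
qed

subsection \<open>The Bessel function of order zero\<close>

text \<open>Wallis' integrals. The recursion integrates the derivative of
  \<open>- cos t * sin t ^ (2 * k + 1)\<close>, a function that vanishes at 0 and at
  \<open>pi\<close>.\<close>

lemma has_integral_sin_even_power:
  "((\<lambda>t. sin t ^ (2 * k)) has_integral (pi * fact (2 * k) / (4 ^ k * (fact k)\<^sup>2))) {0..pi::real}"
proof (induction k)
  case 0
  show ?case using has_integral_const_real[of "1::real" 0 pi] by simp
next
  case (Suc k)
  let ?I = "pi * fact (2 * k) / (4 ^ k * (fact k)\<^sup>2) :: real"
  have "((\<lambda>t. real (2 * k + 2) * sin t ^ (2 * k + 2) - real (2 * k + 1) * sin t ^ (2 * k)) has_integral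
      (- cos pi * sin pi ^ (2 * k + 1) - (- cos 0 * sin 0 ^ (2 * k + 1)))) {0..pi::real}"
  proof (rule fundamental_theorem_of_calculus)
    fix t :: real
    have "sin t * sin t = 1 - cos t * cos t" using sin_cos_squared_add[of t] by (simp add: power2_eq_square)
    then have c: "cos t * cos t = 1 - sin t * sin t" by simp
    have "((\<lambda>t. sin t ^ Suc (2 * k)) has_field_derivative (1 + of_nat (2 * k)) * (cos t * sin t ^ (2 * k))) (at t within {0..pi})"
      by (intro DERIV_power_Suc) (auto intro!: derivative_eq_intros)
    moreover have "((\<lambda>t. - cos t) has_field_derivative sin t) (at t within {0..pi})"
      by (auto intro!: derivative_eq_intros)
    ultimately have "((\<lambda>t. - cos t * sin t ^ Suc (2 * k)) has_field_derivative
       (- cos t * ((1 + of_nat (2 * k)) * (cos t * sin t ^ (2 * k))) + sin t * sin t ^ Suc (2 * k))) (at t within {0..pi})"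
      by (rule DERIV_mult'[rotated])
    also have "- cos t * ((1 + of_nat (2 * k)) * (cos t * sin t ^ (2 * k))) + sin t * sin t ^ Suc (2 * k)
        = sin t * sin t ^ (2 * k + 1) - cos t * (real (2 * k + 1) * sin t ^ (2 * k) * cos t)"
      by (simp add: algebra_simps)
    also have "cos t * (real (2 * k + 1) * sin t ^ (2 * k) * cos t) = real (2 * k + 1) * sin t ^ (2 * k) * (cos t * cos t)"
      by (simp only: mult_ac)
    also have "sin t * sin t ^ (2 * k + 1) - \<dots> = real (2 * k + 2) * sin t ^ (2 * k + 2) - real (2 * k + 1) * sin t ^ (2 * k)"
      unfolding c by (simp add: algebra_simps)
    finally show "((\<lambda>t. - cos t * sin t ^ (2 * k + 1)) has_vector_derivative
       (real (2 * k + 2) * sin t ^ (2 * k + 2) - real (2 * k + 1) * sin t ^ (2 * k))) (at t within {0..pi})"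
      by (simp only: has_real_derivative_iff_has_vector_derivative Suc_eq_plus1)
  qed simp
  then have "((\<lambda>t. real (2 * k + 2) * sin t ^ (2 * k + 2) - real (2 * k + 1) * sin t ^ (2 * k)) has_integral 0) {0..pi::real}"
    by simp
  from has_integral_add[OF this has_integral_mult_right[OF Suc.IH, of "real (2 * k + 1)"]]
  have "((\<lambda>t. real (2 * k + 2) * sin t ^ (2 * k + 2)) has_integral (real (2 * k + 1) * ?I)) {0..pi::real}" by simp
  from has_integral_mult_right[OF this, of "1 / real (2 * k + 2)"]
  have "((\<lambda>t. sin t ^ (2 * k + 2)) has_integral (1 / real (2 * k + 2) * (real (2 * k + 1) * ?I))) {0..pi::real}"
    by (simp del: of_nat_add of_nat_mult)
  moreover have "1 / real (2 * k + 2) * (real (2 * k + 1) * ?I) = pi * fact (2 * Suc k) / (4 ^ Suc k * (fact (Suc k))\<^sup>2)"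
    by (simp add: divide_simps power2_eq_square) (simp add: algebra_simps)
  ultimately show ?case by simp
qed

text \<open>Bessel's integral: the cosine series is integrated term by term with Wallis' integrals,
  which uniform convergence on the compact interval permits.\<close>

lemma bessel_J_0_has_integral:
  "((\<lambda>t. cos (x * sin t)) has_integral (pi * bessel_J 0 x)) {0..pi}"
proof -
  define f where "f k t = (-1) ^ k / fact (2 * k) * (x * sin t) ^ (2 * k)" for k t
  have sums: "(\<lambda>k. f k t) sums cos (x * sin t)" for t
    unfolding f_def by (rule cos_paired)
  have f_int: "(f k has_integral (pi * ((-1) ^ k / (fact k * fact (k + 0)) * (x / 2) ^ (2 * k + 0)))) {0..pi}" for k
  proof -
    have "((\<lambda>t. (-1) ^ k / fact (2 * k) * x ^ (2 * k) * sin t ^ (2 * k)) has_integral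
      (-1) ^ k / fact (2 * k) * x ^ (2 * k) * (pi * fact (2 * k) / (4 ^ k * (fact k)\<^sup>2))) {0..pi}"
      by (intro has_integral_mult_right has_integral_sin_even_power)
    moreover have "(-1) ^ k / fact (2 * k) * x ^ (2 * k) * (pi * fact (2 * k) / (4 ^ k * (fact k)\<^sup>2))
       = pi * ((-1) ^ k / (fact k * fact (k + 0)) * (x / 2) ^ (2 * k + 0))"
    proof -
      have "(4::real) ^ k = 2 ^ k * 2 ^ k" by (simp flip: power_mult_distrib)
      then show ?thesis by (simp add: power_divide power_mult power2_eq_square power_mult_distrib mult_ac)
    qed
    ultimately show ?thesis by (simp add: f_def[abs_def] power_mult_distrib mult.assoc)
  qed
  \<comment> \<open>The factorial of \<open>2 * k\<close> is weakened to that of \<open>k\<close>,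
    so that the majorant is the exponential series at \<open>x\<^sup>2\<close>.\<close>
  have "uniform_limit {0..pi} (\<lambda>n t. \<Sum>k<n. f k t) (\<lambda>t. \<Sum>k. f k t) sequentially"
  proof (rule Weierstrass_m_test)
    fix k t
    have "\<bar>x * sin t\<bar> ^ (2 * k) \<le> \<bar>x\<bar> ^ (2 * k)"
      by (intro power_mono) (auto simp: abs_mult mult_left_le)
    moreover have "fact k \<le> (fact (2 * k) :: real)" by (intro fact_mono) simp
    ultimately have "\<bar>x * sin t\<bar> ^ (2 * k) / fact (2 * k) \<le> \<bar>x\<bar> ^ (2 * k) / fact k"
      by (intro frac_le) auto
    then show "norm (f k t) \<le> (x\<^sup>2) ^ k / fact k"
      by (simp add: f_def abs_mult power_abs power_mult)
  next
    show "summable (\<lambda>k. (x\<^sup>2) ^ k / fact k)"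
      using summable_exp[of "x\<^sup>2"] by (simp add: divide_inverse mult.commute)
  qed
  moreover have "(\<lambda>t. \<Sum>k. f k t) = (\<lambda>t. cos (x * sin t))"
    using sums by (auto simp: sums_iff)
  ultimately have ul: "uniform_limit {0..pi} (\<lambda>n t. \<Sum>k<n. f k t) (\<lambda>t. cos (x * sin t)) sequentially"
    by simp
  obtain I J where I: "\<And>n. ((\<lambda>t. \<Sum>k<n. f k t) has_integral I n) {0..pi}"
    and J: "((\<lambda>t. cos (x * sin t)) has_integral J) {0..pi}" and lim: "I \<longlonglongrightarrow> J"
    by (rule uniform_limit_integral[OF ul]) (auto simp: f_def[abs_def] intro!: continuous_intros)
  have "I = (\<lambda>n. \<Sum>k<n. pi * ((-1) ^ k / (fact k * fact (k + 0)) * (x / 2) ^ (2 * k + 0)))"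
    using has_integral_unique[OF I has_integral_sum[OF _ f_int]] by auto
  with lim have "(\<lambda>k. pi * ((-1) ^ k / (fact k * fact (k + 0)) * (x / 2) ^ (2 * k + 0))) sums J"
    unfolding sums_def by (simp only:)
  from sums_mult[OF this, of "1 / pi"]
  have "(\<lambda>k. (-1) ^ k / (fact k * fact (k + 0)) * (x / 2) ^ (2 * k + 0)) sums (J / pi)" by simp
  then have "bessel_J 0 x = J / pi" unfolding bessel_J_def by (simp only: sums_iff)
  then show ?thesis using J by simp
qed

lemma abs_bessel_J_0_le_1: "\<bar>bessel_J 0 x\<bar> \<le> 1"
proof -
  have c: "((\<lambda>t. c) has_integral (pi * c)) {0..pi}" for c :: real
    using has_integral_const_real[of c 0 pi] by simp
  have "pi * bessel_J 0 x \<le> pi * 1"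
    by (rule has_integral_le[OF bessel_J_0_has_integral c]) simp
  moreover have "pi * (-1) \<le> pi * bessel_J 0 x"
    by (rule has_integral_le[OF c bessel_J_0_has_integral]) simp
  ultimately have "bessel_J 0 x \<le> 1" "-1 \<le> bessel_J 0 x"
    by (simp_all only: mult_le_cancel_left_pos[OF pi_gt_zero])
  then show ?thesis by simp
qed

text \<open>A mean value 1 of \<open>cos (x * sin t)\<close> would force this continuous function to
  be 1 throughout, but at \<open>t = pi / 2\<close> it equals \<open>cos x\<close>, which is below 1
  in the given range.\<close>

lemma bessel_J_0_less_1:
  assumes "0 < x" "x \<le> pi"
  shows "bessel_J 0 x < 1"
proof (rule ccontr)
  assume "\<not> bessel_J 0 x < 1"
  then have 1: "bessel_J 0 x = 1" using abs_bessel_J_0_le_1[of x] by linarith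
  have "((\<lambda>t. 1 - cos (x * sin t)) has_integral (pi * 1 - pi * bessel_J 0 x)) {0..pi}"
    using has_integral_const_real[of "1::real" 0 pi] by (intro has_integral_diff bessel_J_0_has_integral) simp
  then have 0: "((\<lambda>t. 1 - cos (x * sin t)) has_integral 0) (cbox 0 pi)" unfolding 1 by simp
  have "1 - cos (x * sin (pi / 2)) = 0"
    by (rule has_integral_0_cbox_imp_0[OF _ _ 0]) (use pi_gt_zero in \<open>auto intro!: continuous_intros simp: box_real not_le\<close>)
  moreover have "cos x < cos 0" using assms by (intro cos_monotone_0_pi) auto
  ultimately show False by simp
qed

lemma bessel_J_0_0 [simp]: "bessel_J 0 0 = 1"
proof -
  have "(\<lambda>k. (- 1) ^ k / (fact k * fact (k + 0)) * (0 / 2) ^ (2 * k + 0)) sums (\<Sum>k\<in>{0::nat}. (- 1) ^ k / (fact k * fact (k + 0)) * (0 / 2) ^ (2 * k + 0) :: real)"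
    by (rule sums_finite) auto
  then show ?thesis unfolding bessel_J_def by (simp add: sums_iff)
qed

lemma measurable_bessel_J [measurable]:
  assumes [measurable]: "f \<in> borel_measurable M"
  shows "(\<lambda>x. bessel_J n (f x)) \<in> borel_measurable M"
  unfolding bessel_J_def by measurable

lemma bessel_K_pos:
  assumes "n \<le> 1" "x > 0"
  shows "bessel_K n x > 0"
proof (rule ccontr)
  assume "\<not> bessel_K n x > 0"
  then have "(\<integral>\<^sup>+t. ennreal (kern n x t) \<partial>lborel) = 0"
    using ennreal_bessel_K[OF assms] by (simp add: ennreal_neg)
  then have "AE t in lborel. ennreal (kern n x t) = 0"
    by (subst (asm) nn_integral_0_iff_AE) auto
  moreover have "kern n x t > 0" for t by (simp add: kern_def)
  ultimately have "AE t in (lborel :: real measure). False"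
    by (auto simp: ennreal_eq_0_iff not_le[symmetric])
  then show False by (simp add: AE_iff_measurable[where N=UNIV])
qed

subsection \<open>Bounds for the interaction integrals\<close>

definition hankel :: "nat \<Rightarrow> nat \<Rightarrow> real \<Rightarrow> real \<Rightarrow> real \<Rightarrow> real" where
  "hankel m n a b l = (LBINT \<xi>:{0<..}. \<xi>\<^sup>2 * bessel_J 0 (l * \<xi>) * bessel_K m (a * \<xi>) * bessel_K n (b * \<xi>))"

context
  fixes m n :: nat and a b V :: real
  assumes V: "bessel_KK 2 m n a b = ennreal V" and V_nonneg: "V \<ge> 0"
begin

text \<open>The integrand without its oscillating factor: a nonnegative weight of total mass
  \<open>V\<close>, against which \<open>bessel_J 0\<close> is integrated.\<close>

private definition w :: "real \<Rightarrow> real" where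
  "w \<xi> = indicator {0<..} \<xi> * (\<xi>\<^sup>2 * bessel_K m (a * \<xi>) * bessel_K n (b * \<xi>))"

private lemma w_nonneg: "w \<xi> \<ge> 0" by (simp add: w_def)

private lemma w_measurable [measurable]: "w \<in> borel_measurable borel"
  unfolding w_def[abs_def] by measurable

private lemma nn_integral_w: "(\<integral>\<^sup>+\<xi>. ennreal (w \<xi>) \<partial>lborel) = ennreal V"
  unfolding V[symmetric] bessel_KK_def
  by (intro nn_integral_cong) (auto simp: w_def split: split_indicator)

private lemma w_integrable: "integrable lborel w"
  by (rule integrableI_nonneg) (auto simp: w_nonneg nn_integral_w)

private lemma integral_w: "integral\<^sup>L lborel w = V"
  using V_nonneg by (subst integral_eq_nn_integral) (auto simp: w_nonneg nn_integral_w)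

private lemma hankel_altdef: "hankel m n a b l = (LINT \<xi>|lborel. bessel_J 0 (l * \<xi>) * w \<xi>)"
  unfolding hankel_def set_lebesgue_integral_def
  by (intro Bochner_Integration.integral_cong) (auto simp: w_def)

private lemma hankel_integrable: "integrable lborel (\<lambda>\<xi>. bessel_J 0 (l * \<xi>) * w \<xi>)"
proof (rule Bochner_Integration.integrable_bound[OF w_integrable])
  show "AE \<xi> in lborel. norm (bessel_J 0 (l * \<xi>) * w \<xi>) \<le> norm (w \<xi>)"
    using abs_bessel_J_0_le_1 by (auto simp: abs_mult intro!: mult_left_le_one_le)
qed measurable

lemma hankel_0: "hankel m n a b 0 = V"
  by (simp add: hankel_altdef integral_w)

lemma abs_hankel_le: "\<bar>hankel m n a b l\<bar> \<le> V"
proof -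
  have "\<bar>hankel m n a b l\<bar> \<le> (LINT \<xi>|lborel. \<bar>bessel_J 0 (l * \<xi>) * w \<xi>\<bar>)"
    unfolding hankel_altdef by (rule integral_abs_bound)
  also have "\<dots> \<le> integral\<^sup>L lborel w"
    using abs_bessel_J_0_le_1 w_nonneg
    by (intro integral_mono integrable_abs hankel_integrable w_integrable)
      (auto simp: abs_mult intro!: mult_left_le_one_le)
  finally show ?thesis by (simp add: integral_w)
qed

text \<open>Equality would make the nonnegative function
  \<open>w \<xi> - bessel_J 0 (l * \<xi>) * w \<xi>\<close> vanish almost everywhere, yet it is
  positive on the interval from 0 to \<open>pi / l\<close>.\<close>

lemma hankel_less:
  assumes "m \<le> 1" "n \<le> 1" "a > 0" "b > 0" "l > 0"
  shows "hankel m n a b l < V"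
proof (rule ccontr)
  assume "\<not> hankel m n a b l < V"
  then have "hankel m n a b l = V" using abs_hankel_le[of l] by linarith
  then have "(LINT \<xi>|lborel. w \<xi> - bessel_J 0 (l * \<xi>) * w \<xi>) = 0"
    by (subst Bochner_Integration.integral_diff[OF w_integrable hankel_integrable])
      (simp add: integral_w hankel_altdef)
  moreover have "integrable lborel (\<lambda>\<xi>. w \<xi> - bessel_J 0 (l * \<xi>) * w \<xi>)"
    by (intro Bochner_Integration.integrable_diff w_integrable hankel_integrable)
  moreover have "bessel_J 0 (l * \<xi>) * w \<xi> \<le> w \<xi>" for \<xi>
    using abs_bessel_J_0_le_1[of "l * \<xi>"] w_nonneg[of \<xi>] mult_right_mono[of "bessel_J 0 (l * \<xi>)" 1 "w \<xi>"] by simp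
  ultimately have ae: "AE \<xi> in lborel. w \<xi> - bessel_J 0 (l * \<xi>) * w \<xi> = 0"
    by (subst (asm) integral_nonneg_eq_0_iff_AE) auto
  have "w \<xi> - bessel_J 0 (l * \<xi>) * w \<xi> \<noteq> 0" if "\<xi> \<in> {0<..<pi / l}" for \<xi>
  proof -
    have "w \<xi> > 0" using that assms by (auto simp: w_def intro!: mult_pos_pos bessel_K_pos)
    moreover have "bessel_J 0 (l * \<xi>) < 1"
      using that assms by (intro bessel_J_0_less_1) (auto simp: field_simps)
    ultimately show ?thesis by simp
  qed
  with ae have "AE \<xi> in lborel. \<xi> \<notin> {0<..<pi / l}" by (auto elim!: eventually_mono)
  then have "emeasure lborel {0<..<pi / l} = 0"
    by (subst (asm) AE_iff_measurable[where N="{0<..<pi / l}"]) auto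
  then have "pi / l \<le> 0" using assms by (simp add: ennreal_eq_0_iff)
  then show False using assms pi_gt_zero by (simp add: divide_le_0_iff)
qed

end

lemma F_vv_altdef: "F_vv \<alpha> l = 32 / (3 * pi\<^sup>2) * hankel 1 1 \<alpha> (inverse \<alpha>) l"
  unfolding F_vv_def hankel_def by (simp only: divide_inverse mult.commute[of "inverse \<alpha>"])

lemma F_ss_altdef: "F_ss \<alpha> l = 32 / pi\<^sup>2 * hankel 0 0 \<alpha> (inverse \<alpha>) l"
  unfolding F_ss_def hankel_def by (simp only: divide_inverse mult.commute[of "inverse \<alpha>"])

lemma F_vs_altdef: "F_vs \<alpha> l = 2 * hankel 0 1 \<alpha> (inverse \<alpha>) l"
  unfolding F_vs_def hankel_def by (simp only: divide_inverse mult.commute[of "inverse \<alpha>"])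

lemma bessel_KK_real_le:
  assumes "bessel_KK p m n a b \<le> ennreal C" "C \<ge> 0"
  obtains V where "bessel_KK p m n a b = ennreal V" "0 \<le> V" "V \<le> C"
  using assms by (cases "bessel_KK p m n a b") (auto simp: ennreal_le_iff top_unique)

lemma abs_F_vv_le_1:
  assumes "\<alpha> > 0" shows "\<bar>F_vv \<alpha> l\<bar> \<le> 1"
proof -
  have "bessel_KK 2 1 1 \<alpha> (inverse \<alpha>) \<le> ennreal (3 * pi\<^sup>2 / 32)"
    unfolding bessel_KK_2_1_1[symmetric] using assms by (intro bessel_KK_le_diagonal) auto
  then obtain V where V: "bessel_KK 2 1 1 \<alpha> (inverse \<alpha>) = ennreal V" "0 \<le> V" "V \<le> 3 * pi\<^sup>2 / 32"
    by (rule bessel_KK_real_le) auto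
  have "\<bar>hankel 1 1 \<alpha> (inverse \<alpha>) l\<bar> \<le> 3 * pi\<^sup>2 / 32"
    using abs_hankel_le[OF V(1,2), of l] V(3) by linarith
  then show ?thesis unfolding F_vv_altdef by (simp add: abs_mult field_simps)
qed

lemma abs_F_ss_le_1:
  assumes "\<alpha> > 0" shows "\<bar>F_ss \<alpha> l\<bar> \<le> 1"
proof -
  have "bessel_KK 2 0 0 \<alpha> (inverse \<alpha>) \<le> ennreal (pi\<^sup>2 / 32)"
    unfolding bessel_KK_2_0_0[symmetric] using assms by (intro bessel_KK_le_diagonal) auto
  then obtain V where V: "bessel_KK 2 0 0 \<alpha> (inverse \<alpha>) = ennreal V" "0 \<le> V" "V \<le> pi\<^sup>2 / 32"
    by (rule bessel_KK_real_le) auto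
  have "\<bar>hankel 0 0 \<alpha> (inverse \<alpha>) l\<bar> \<le> pi\<^sup>2 / 32"
    using abs_hankel_le[OF V(1,2), of l] V(3) by linarith
  then show ?thesis unfolding F_ss_altdef by (simp add: abs_mult field_simps)
qed

text \<open>By symmetry in the two factors, the integrals for \<alpha> and its inverse are the two
  mixed integrals at one pair of scales, so their joint bound applies.\<close>

lemma abs_F_vs_sum_le_2:
  assumes "\<alpha> > 0" shows "\<bar>F_vs \<alpha> l\<bar> + \<bar>F_vs (inverse \<alpha>) l\<bar> \<le> 2"
proof -
  let ?P = "bessel_KK 2 0 1 \<alpha> (inverse \<alpha>)" and ?Q = "bessel_KK 2 0 1 (inverse \<alpha>) \<alpha>"
  have PQ: "?P + ?Q \<le> ennreal 1"
    using bessel_KK_2_0_1_plus_2_1_0_le[of \<alpha> "inverse \<alpha>"] assms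
    by (subst (2) bessel_KK_commute) simp
  have "?P \<le> ?P + ?Q" "?Q \<le> ?P + ?Q" by simp_all
  with PQ have "?P \<le> ennreal 1" "?Q \<le> ennreal 1" using order_trans by blast+
  then obtain P Q where P: "?P = ennreal P" "0 \<le> P" and Q: "?Q = ennreal Q" "0 \<le> Q"
    by (metis bessel_KK_real_le zero_le_one)
  have "P + Q \<le> 1" using PQ P Q by (simp add: ennreal_plus[symmetric] del: ennreal_plus)
  then show ?thesis
    using abs_hankel_le[OF P, of l] abs_hankel_le[OF Q, of l] by (simp add: F_vs_altdef abs_mult)
qed

lemma F_vv_1_0: "F_vv 1 0 = 1"
  unfolding F_vv_altdef using hankel_0[of 1 1 1 1, OF bessel_KK_2_1_1] by simp

lemma F_ss_1_0: "F_ss 1 0 = 1"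
  unfolding F_ss_altdef using hankel_0[of 0 0 1 1, OF bessel_KK_2_0_0] by simp

lemma F_vs_1_0: "F_vs 1 0 = 1"
  unfolding F_vs_altdef using hankel_0[of 0 1 1 1, OF bessel_KK_2_0_1] by simp

text \<open>This strictness is what forces the two centres of a minimizer to coincide.\<close>

lemma F_ss_1_less_1:
  assumes "l > 0" shows "F_ss 1 l < 1"
  unfolding F_ss_altdef using hankel_less[of 0 0 1 1, OF bessel_KK_2_0_0 _ _ _ _ _ assms]
  by (simp add: field_simps)

subsection \<open>The energy\<close>

text \<open>With \<open>w = log_radius \<rho>\<close> one has \<open>\<rho> = 2 * exp (w - 1 - \<gamma>)\<close>, so \<open>\<rho> * w\<close> is a
  multiple of \<open>w * exp w\<close>, and the bound on \<open>L\<^sub>0\<close> makes \<open>w < -1\<close> on the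
  admissible radii.\<close>

definition log_radius :: "real \<Rightarrow> real" where
  "log_radius \<rho> = 1 + euler_mascheroni - ln 2 + ln \<rho>"

text \<open>Half the energy of the optimal configuration with both radii equal to \<rho>. Per layer,
  the coefficient of \<open>\<delta> * \<rho>\<close> collects \<open>pi^3 / 4\<close> from the
  layer itself, \<open>- pi^3 / 2\<close> from \<open>F_vv\<close> and \<open>F_ss\<close>, and
  \<open>- 4 * pi\<close> from \<open>F_vs\<close>.\<close>

definition reduced_energy :: "real \<Rightarrow> real \<Rightarrow> real" where
  "reduced_energy \<delta> \<rho> = - 4 * pi * \<rho>\<^sup>2 * (2 * log_radius \<rho> - 1) - pi * (16 + pi\<^sup>2) / 4 * \<delta> * \<rho>"

lemma ln_radius_eq:
  assumes "\<rho> > 0"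
  shows "ln (exp (1 + 2 * euler_mascheroni) / 4 * \<rho>\<^sup>2) = 2 * log_radius \<rho> - 1"
proof -
  have "ln (4::real) = 2 * ln 2" using ln_realpow[of "2::real" 2] by simp
  then show ?thesis
    using assms by (simp add: ln_mult ln_div ln_realpow log_radius_def)
qed

text \<open>The rest of the energy divided by \<delta>, grouped so that each bracket belongs to one
  type of interaction and is nonnegative by itself.\<close>

definition excess :: "real \<Rightarrow> real \<Rightarrow> real \<Rightarrow> real \<Rightarrow> real \<Rightarrow> real" where
  "excess \<rho>1 \<rho>2 c1 c2 l = (let m = sqrt (\<rho>1 * \<rho>2); \<alpha> = sqrt (\<rho>2 / \<rho>1) in
     3 * pi ^ 3 / 8 * (\<rho>1 * c1\<^sup>2 + \<rho>2 * c2\<^sup>2 + 2 * m * c1 * c2 * F_vv \<alpha> l)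
   + pi ^ 3 / 8 * (\<rho>1 + \<rho>2 - 2 * m * F_ss \<alpha> l)
   + 4 * pi * (\<rho>1 + \<rho>2 - m * (c1 * F_vs \<alpha> l - c2 * F_vs (inverse \<alpha>) l)))"

lemma F2_eq_reduced_energy:
  assumes "\<rho>1 > 0" "\<rho>2 > 0"
  shows "F2 \<delta> (\<rho>1, \<rho>2, \<theta>1, \<theta>2, r1, r2) = reduced_energy \<delta> \<rho>1 + reduced_energy \<delta> \<rho>2
    + \<delta> * excess \<rho>1 \<rho>2 (cos \<theta>1) (cos \<theta>2) (norm (r2 - r1) / sqrt (\<rho>1 * \<rho>2))"
  unfolding F2.simps layer_energy_def ln_radius_eq[OF assms(1)] ln_radius_eq[OF assms(2)]
    reduced_energy_def excess_def Let_def
  by (simp add: field_simps power2_eq_square power3_eq_cube)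

text \<open>With \<open>p\<close> and \<open>q\<close> the roots of the radii,
  \<open>m = p * q\<close> and \<open>2 * m\<close> is at most the sum of the radii. This and the
  bounds on \<open>F_vv\<close>, \<open>F_ss\<close> and the sum of the \<open>F_vs\<close> terms
  settle one bracket each.\<close>

lemma excess_parts_nonneg:
  fixes \<rho>1 \<rho>2 c1 c2 l :: real
  defines "m \<equiv> sqrt (\<rho>1 * \<rho>2)" and "\<alpha> \<equiv> sqrt (\<rho>2 / \<rho>1)"
  assumes "\<rho>1 > 0" "\<rho>2 > 0" "\<bar>c1\<bar> \<le> 1" "\<bar>c2\<bar> \<le> 1"
  shows "0 \<le> \<rho>1 * c1\<^sup>2 + \<rho>2 * c2\<^sup>2 + 2 * m * c1 * c2 * F_vv \<alpha> l"
    and "0 \<le> \<rho>1 + \<rho>2 - 2 * m * F_ss \<alpha> l"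
    and "0 \<le> \<rho>1 + \<rho>2 - m * (c1 * F_vs \<alpha> l - c2 * F_vs (inverse \<alpha>) l)"
proof -
  define p q where "p = sqrt \<rho>1" and "q = sqrt \<rho>2"
  have pq: "p > 0" "q > 0" "\<rho>1 = p\<^sup>2" "\<rho>2 = q\<^sup>2" "m = p * q"
    using assms by (auto simp: p_def q_def m_def real_sqrt_mult)
  have \<alpha>: "\<alpha> > 0" using assms by (simp add: \<alpha>_def)
  have m2: "2 * m \<le> \<rho>1 + \<rho>2"
    using sum_squares_bound[of p q] unfolding pq by simp
  have m: "m > 0" using pq by simp
  show "0 \<le> \<rho>1 * c1\<^sup>2 + \<rho>2 * c2\<^sup>2 + 2 * m * c1 * c2 * F_vv \<alpha> l"
  proof -
    have "2 * \<bar>p * c1\<bar> * \<bar>q * c2\<bar> \<le> \<bar>p * c1\<bar>\<^sup>2 + \<bar>q * c2\<bar>\<^sup>2" by (rule sum_squares_bound)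
    moreover have "2 * \<bar>p * c1\<bar> * \<bar>q * c2\<bar> * \<bar>F_vv \<alpha> l\<bar> \<le> 2 * \<bar>p * c1\<bar> * \<bar>q * c2\<bar>"
      using abs_F_vv_le_1[OF \<alpha>, of l] by (intro mult_left_le) auto
    moreover have "2 * \<bar>p * c1\<bar> * \<bar>q * c2\<bar> * \<bar>F_vv \<alpha> l\<bar> = \<bar>2 * m * c1 * c2 * F_vv \<alpha> l\<bar>"
      by (simp add: pq abs_mult mult_ac)
    moreover have "\<bar>p * c1\<bar>\<^sup>2 + \<bar>q * c2\<bar>\<^sup>2 = \<rho>1 * c1\<^sup>2 + \<rho>2 * c2\<^sup>2"
      by (simp add: pq power_mult_distrib)
    ultimately show ?thesis by linarith
  qed
  show "0 \<le> \<rho>1 + \<rho>2 - 2 * m * F_ss \<alpha> l"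
  proof -
    have "F_ss \<alpha> l \<le> 1" using abs_F_ss_le_1[OF \<alpha>, of l] by simp
    then have "2 * m * F_ss \<alpha> l \<le> 2 * m * 1" using m by (intro mult_left_mono) auto
    then show ?thesis using m2 by simp
  qed
  show "0 \<le> \<rho>1 + \<rho>2 - m * (c1 * F_vs \<alpha> l - c2 * F_vs (inverse \<alpha>) l)"
  proof -
    have "\<bar>c1 * F_vs \<alpha> l\<bar> \<le> \<bar>F_vs \<alpha> l\<bar>" "\<bar>c2 * F_vs (inverse \<alpha>) l\<bar> \<le> \<bar>F_vs (inverse \<alpha>) l\<bar>"
      using assms by (auto simp: abs_mult intro!: mult_left_le_one_le)
    then have "c1 * F_vs \<alpha> l - c2 * F_vs (inverse \<alpha>) l \<le> 2"
      using abs_F_vs_sum_le_2[OF \<alpha>, of l] by linarith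
    then have "m * (c1 * F_vs \<alpha> l - c2 * F_vs (inverse \<alpha>) l) \<le> m * 2"
      using m by (intro mult_left_mono) auto
    then show ?thesis using m2 by linarith
  qed
qed

lemma excess_nonneg:
  assumes "\<rho>1 > 0" "\<rho>2 > 0" "\<bar>c1\<bar> \<le> 1" "\<bar>c2\<bar> \<le> 1"
  shows "0 \<le> excess \<rho>1 \<rho>2 c1 c2 l"
proof -
  note p = excess_parts_nonneg[OF assms, of l]
  show ?thesis unfolding excess_def Let_def
    by (rule add_nonneg_nonneg[OF add_nonneg_nonneg[OF mult_nonneg_nonneg[OF _ p(1)]
      mult_nonneg_nonneg[OF _ p(2)]] mult_nonneg_nonneg[OF _ p(3)]]) simp_all
qed

text \<open>Equal radii suffice, since \<open>reduced_energy\<close> determines both radii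
  separately. The bracket with \<open>F_ss\<close> then forces \<open>l = 0\<close>, and the one
  with \<open>F_vs\<close> becomes \<open>c1 - c2 = 2\<close>.\<close>

lemma excess_eq_0_iff:
  assumes "\<rho> > 0" "\<bar>c1\<bar> \<le> 1" "\<bar>c2\<bar> \<le> 1" "l \<ge> 0"
  shows "excess \<rho> \<rho> c1 c2 l = 0 \<longleftrightarrow> l = 0 \<and> c1 = 1 \<and> c2 = -1"
proof
  assume "l = 0 \<and> c1 = 1 \<and> c2 = -1"
  then show "excess \<rho> \<rho> c1 c2 l = 0"
    using assms by (simp add: excess_def F_vv_1_0 F_ss_1_0 F_vs_1_0)
next
  assume e: "excess \<rho> \<rho> c1 c2 l = 0"
  note p = excess_parts_nonneg[OF assms(1,1,2,3), of l]
  have *: "3 * pi ^ 3 / 8 > 0" "pi ^ 3 / 8 > 0" "4 * pi > 0" by simp_all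
  have sum0: "Y = 0 \<and> Z = 0" if "a * X + b * Y + c * Z = 0" "0 < a" "0 < b" "0 < c" "0 \<le> X" "0 \<le> Y" "0 \<le> Z"
    for a b c X Y Z :: real
    using that mult_nonneg_nonneg[of a X] mult_nonneg_nonneg[of b Y] mult_nonneg_nonneg[of c Z]
    by (simp add: add_nonneg_eq_0_iff)
  have "\<rho> + \<rho> - 2 * sqrt (\<rho> * \<rho>) * F_ss (sqrt (\<rho> / \<rho>)) l = 0
     \<and> \<rho> + \<rho> - sqrt (\<rho> * \<rho>) * (c1 * F_vs (sqrt (\<rho> / \<rho>)) l - c2 * F_vs (inverse (sqrt (\<rho> / \<rho>))) l) = 0"
    by (rule sum0[OF e[unfolded excess_def Let_def] * p])
  moreover have "sqrt (\<rho> * \<rho>) = \<rho>" "sqrt (\<rho> / \<rho>) = 1" using assms(1) by auto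
  ultimately have "\<rho> * F_ss 1 l = \<rho> * 1" and 3: "\<rho> * (c1 * F_vs 1 l - c2 * F_vs 1 l) = \<rho> * 2"
    by auto
  then have "F_ss 1 l = 1" using assms(1) by simp
  then have l: "l = 0" using F_ss_1_less_1[of l] assms(4) by force
  have "c1 - c2 = 2" using 3 assms(1) by (simp add: l F_vs_1_0)
  then show "l = 0 \<and> c1 = 1 \<and> c2 = -1" using assms l by linarith
qed

section \<open>Minimization over a single radius and the Lambert function\<close>

lemma log_radius_mono: "0 < x \<Longrightarrow> x < y \<Longrightarrow> log_radius x < log_radius y"
  by (simp add: log_radius_def)

text \<open>The derivative is \<open>log_radius z + 1\<close>, negative strictly inside the interval
  even if \<open>log_radius y = -1\<close>. Up to a constant factor this is the strict convexity of
  \<open>reduced_energy\<close>.\<close>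

lemma radius_log_radius_strict_antimono:
  assumes "0 < x" "x < y" "log_radius y \<le> -1"
  shows "y * log_radius y < x * log_radius x"
proof (rule DERIV_neg_imp_decreasing_open[OF assms(2)])
  fix z assume z: "x < z" "z < y"
  then have "log_radius z < -1" using log_radius_mono[of z y] assms by linarith
  moreover have "DERIV (\<lambda>z. z * log_radius z) z :> log_radius z + 1"
    unfolding log_radius_def using z assms by (auto intro!: derivative_eq_intros)
  ultimately show "\<exists>d. DERIV (\<lambda>z. z * log_radius z) z :> d \<and> d < 0" by force
next
  show "continuous_on {x..y} (\<lambda>z. z * log_radius z)"
    unfolding log_radius_def using assms by (auto intro!: continuous_intros)
qed

text \<open>The derivative is \<open>- 16 * pi\<close> times the difference of
  \<open>z * log_radius z\<close> and its value at \<open>\<rho>'\<close>. By strict antitonicity it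
  is negative to the left of \<open>\<rho>'\<close> and positive to the right.\<close>

lemma reduced_energy_unique_minimum:
  assumes "0 < \<rho>" "0 < \<rho>'" "\<rho> \<noteq> \<rho>'" "log_radius \<rho> \<le> -1" "log_radius \<rho>' \<le> -1"
    and crit: "- (\<rho>' * log_radius \<rho>') = (16 + pi\<^sup>2) * \<delta> / 64"
  shows "reduced_energy \<delta> \<rho>' < reduced_energy \<delta> \<rho>"
proof -
  have D: "DERIV (reduced_energy \<delta>) z :> - 16 * pi * (z * log_radius z - \<rho>' * log_radius \<rho>')" if "z > 0" for z
  proof -
    have "DERIV (reduced_energy \<delta>) z :> - 16 * pi * (z * log_radius z) - pi * (16 + pi\<^sup>2) / 4 * \<delta>"
      unfolding reduced_energy_def[abs_def] log_radius_def using that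
      by (auto intro!: derivative_eq_intros simp: power2_eq_square field_simps)
    also have "- 16 * pi * (z * log_radius z) - pi * (16 + pi\<^sup>2) / 4 * \<delta>
        = - 16 * pi * (z * log_radius z) - 16 * pi * ((16 + pi\<^sup>2) * \<delta> / 64)" by simp
    also have "\<dots> = - 16 * pi * (z * log_radius z - \<rho>' * log_radius \<rho>')"
      unfolding crit[symmetric] by (simp add: algebra_simps)
    finally show ?thesis .
  qed
  consider "\<rho> < \<rho>'" | "\<rho>' < \<rho>" using assms by linarith
  then show ?thesis
  proof cases
    case 1
    show ?thesis
    proof (rule DERIV_neg_imp_decreasing_open[OF 1])
      fix z assume z: "\<rho> < z" "z < \<rho>'"
      have "\<rho>' * log_radius \<rho>' < z * log_radius z"
        using z assms by (intro radius_log_radius_strict_antimono) auto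
      then have "- 16 * pi * (z * log_radius z - \<rho>' * log_radius \<rho>') < 0" by simp
      then show "\<exists>d. DERIV (reduced_energy \<delta>) z :> d \<and> d < 0" using D[of z] z assms by force
    next
      show "continuous_on {\<rho>..\<rho>'} (reduced_energy \<delta>)"
        by (intro continuous_at_imp_continuous_on ballI DERIV_isCont[OF D]) (use assms in auto)
    qed
  next
    case 2
    show ?thesis
    proof (rule DERIV_pos_imp_increasing_open[OF 2])
      fix z assume z: "\<rho>' < z" "z < \<rho>"
      have "log_radius z \<le> -1" using log_radius_mono[of z \<rho>] z assms by linarith
      then have "z * log_radius z < \<rho>' * log_radius \<rho>'"
        using z assms by (intro radius_log_radius_strict_antimono) auto
      then have "- 16 * pi * (z * log_radius z - \<rho>' * log_radius \<rho>') > 0"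
        by (simp add: mult_less_0_iff)
      then show "\<exists>d. DERIV (reduced_energy \<delta>) z :> d \<and> d > 0" using D[of z] z assms by force
    next
      show "continuous_on {\<rho>'..\<rho>} (reduced_energy \<delta>)"
        by (intro continuous_at_imp_continuous_on ballI DERIV_isCont[OF D]) (use assms in auto)
    qed
  qed
qed

text \<open>The map \<open>w * exp w\<close> is strictly decreasing for \<open>w \<le> -1\<close>,
  so any solution there is the one picked by \<open>THE\<close>.\<close>

lemma lambert_W_m1_eqI:
  assumes "w \<le> -1" "w * exp w = t"
  shows "lambert_W_m1 t = w"
  unfolding lambert_W_m1_def
proof (rule the_equality)
  have less: "v * exp v < u * exp u" if "u < v" "v \<le> -1" for u v :: real
  proof (rule DERIV_neg_imp_decreasing_open[OF that(1)])
    fix z assume "u < z" "z < v"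
    then have "(1 + z) * exp z < 0" using that by (simp add: mult_less_0_iff)
    moreover have "DERIV (\<lambda>z. z * exp z) z :> (1 + z) * exp z"
      by (auto intro!: derivative_eq_intros simp: algebra_simps)
    ultimately show "\<exists>d. DERIV (\<lambda>z. z * exp z) z :> d \<and> d < 0" by blast
  qed (auto intro!: continuous_intros)
  fix v assume "v \<le> -1 \<and> v * exp v = t"
  then show "v = w" using assms less[of v w] less[of w v] by force
qed (use assms in auto)

text \<open>In the variable \<open>w = log_radius \<rho>\<close> the critical equation reads
  \<open>w * exp w = t\<close>. The intermediate value theorem gives a solution below
  \<open>log_radius R\<close>, hence on the lower Lambert branch.\<close>

lemma exists_critical_radius:
  assumes "R > 0" "log_radius R \<le> -1" "0 < \<delta>" "(16 + pi\<^sup>2) * \<delta> / 64 < - (R * log_radius R)"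
  obtains \<rho> where "0 < \<rho>" "\<rho> < R" "- (\<rho> * log_radius \<rho>) = (16 + pi\<^sup>2) * \<delta> / 64"
    "\<rho> = (16 + pi\<^sup>2) * \<delta> / (- 64 * lambert_W_m1 (- ((16 + pi\<^sup>2) / 128) * exp (1 + euler_mascheroni) * \<delta>))"
proof -
  \<comment> \<open>The factor for which \<open>exp (log_radius r) = E * r\<close>.\<close>
  define E where "E = exp (1 + euler_mascheroni) / (2::real)"
  define t where "t = - ((16 + pi\<^sup>2) / 128) * exp (1 + euler_mascheroni) * \<delta>"
  have E: "E > 0" by (simp add: E_def)
  have c: "(16 + pi\<^sup>2) * \<delta> / 64 > 0" using assms by (intro divide_pos_pos mult_pos_pos add_pos_nonneg) auto
  have t: "t = - (E * ((16 + pi\<^sup>2) * \<delta> / 64))" by (simp add: t_def E_def)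
  have exp_log: "exp (log_radius r) = E * r" if "r > 0" for r
    using that by (simp add: log_radius_def exp_add exp_diff E_def)
  have "((\<lambda>w::real. w * exp w) \<longlongrightarrow> 0) at_bot" by real_asymp
  moreover have "t < 0" using t c E by simp
  ultimately have "eventually (\<lambda>w. t < w * exp w) at_bot" by (rule order_tendstoD(1))
  then obtain w0 where w0: "\<And>w. w \<le> w0 \<Longrightarrow> t < w * exp w" by (auto simp: eventually_at_bot_linorder)
  have R: "log_radius R * exp (log_radius R) < t"
  proof -
    have "log_radius R * exp (log_radius R) = - (E * - (R * log_radius R))"
      by (simp add: exp_log assms(1))
    also have "\<dots> < t"
      unfolding t neg_less_iff_less by (rule mult_strict_left_mono[OF assms(4) E])
    finally show ?thesis .
  qed
  \<comment> \<open>The minimum keeps the interval nonempty if \<open>w0\<close> exceeds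
    \<open>log_radius R\<close>.\<close>
  have "\<exists>w. min w0 (log_radius R) \<le> w \<and> w \<le> log_radius R \<and> w * exp w = t"
    using R w0[of "min w0 (log_radius R)"] by (intro IVT2) (auto intro!: continuous_intros)
  then obtain w where w: "w \<le> log_radius R" "w * exp w = t" by blast
  with R have wR: "w < log_radius R" by (cases "w = log_radius R") auto
  define \<rho> where "\<rho> = exp w / E"
  have \<rho>: "\<rho> > 0" using E by (simp add: \<rho>_def)
  have "exp (log_radius \<rho>) = exp w" using exp_log[OF \<rho>] E by (simp add: \<rho>_def)
  then have lw: "log_radius \<rho> = w" by simp
  show thesis
  proof
    show "\<rho> > 0" by (rule \<rho>)
    show "\<rho> < R" using log_radius_mono[of R \<rho>] assms(1) wR lw by (cases "\<rho> = R") force+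
    show crit: "- (\<rho> * log_radius \<rho>) = (16 + pi\<^sup>2) * \<delta> / 64"
    proof -
      have "- (\<rho> * w) = - (w * exp w) / E" by (simp add: \<rho>_def)
      also have "\<dots> = (16 + pi\<^sup>2) * \<delta> / 64" using E by (simp add: w(2) t)
      finally show ?thesis unfolding lw .
    qed
    have "lambert_W_m1 t = w" using w assms by (intro lambert_W_m1_eqI) auto
    moreover have "w < 0" using w assms by linarith
    ultimately have "\<rho> = (16 + pi\<^sup>2) * \<delta> / (- 64 * lambert_W_m1 t)"
      using crit unfolding lw by (simp add: field_simps)
    then show "\<rho> = (16 + pi\<^sup>2) * \<delta> / (- 64 * lambert_W_m1 (- ((16 + pi\<^sup>2) / 128) * exp (1 + euler_mascheroni) * \<delta>))"
      unfolding t_def .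
  qed
qed

lemma cos_eq_1_imp_0: "\<theta> \<in> {-pi..<pi} \<Longrightarrow> cos \<theta> = 1 \<Longrightarrow> \<theta> = 0"
  using cos_monotone_0_pi[of 0 "\<bar>\<theta>\<bar>"] by fastforce

text \<open>The half-open range contains \<open>- pi\<close> but not \<open>pi\<close>, which makes
  the angle unique.\<close>

lemma cos_eq_minus_1_imp: "\<theta> \<in> {-pi..<pi} \<Longrightarrow> cos \<theta> = -1 \<Longrightarrow> \<theta> = - pi"
  using cos_monotone_0_pi[of "\<bar>\<theta>\<bar>" pi] by fastforce

theorem theorem2:
  fixes L0 :: real
  assumes "L0 > 1 / 2 * exp (2 + euler_mascheroni)"
  shows "\<exists>\<delta>0>0. \<forall>\<delta>. 0 < \<delta> \<and> \<delta> < \<delta>0 \<longrightarrow>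
    (\<exists>c. is_minimizer L0 \<delta> c) \<and>
    (\<forall>\<rho>1 \<rho>2 \<theta>1 \<theta>2 r1 r2. is_minimizer L0 \<delta> (\<rho>1, \<rho>2, \<theta>1, \<theta>2, r1, r2) \<longrightarrow>
       r1 = r2 \<and>
       \<theta>1 = 0 \<and> \<theta>2 = - pi \<and>
       \<rho>1 = \<rho>2 \<and>
       \<rho>1 = (16 + pi\<^sup>2) * \<delta> /
         (- 64 * lambert_W_m1 (- ((16 + pi\<^sup>2) / 128) * exp (1 + euler_mascheroni) * \<delta>)))"
proof -
  define R where "R = inverse L0"
  have "0 < 1 / 2 * exp (2 + euler_mascheroni :: real)" by simp
  with assms have L0: "L0 > 0" by linarith
  then have R: "R > 0" by (simp add: R_def)
  \<comment> \<open>The logarithmic form of the hypothesis is exactly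
    \<open>log_radius R < -1\<close>.\<close>
  have "ln (1 / 2 * exp (2 + euler_mascheroni)) < ln L0"
    using assms L0 by (subst ln_less_cancel_iff) auto
  then have logR: "log_radius R < -1"
    using L0 by (simp add: log_radius_def R_def ln_mult ln_div ln_inverse)
  \<comment> \<open>Below this threshold the right side of the critical equation stays under
    \<open>- (R * log_radius R)\<close>, so the critical radius lies strictly inside the admissible
    interval.\<close>
  define \<delta>0 where "\<delta>0 = 64 * - (R * log_radius R) / (16 + pi\<^sup>2)"
  have pos: "16 + pi\<^sup>2 > 0" by (simp add: add_pos_nonneg)
  have "R * log_radius R < 0" using R logR by (intro mult_pos_neg) auto
  then have "\<delta>0 > 0" using pos by (simp add: \<delta>0_def divide_neg_pos)
  moreover
  {
    fix \<delta> assume \<delta>: "0 < \<delta>" "\<delta> < \<delta>0"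
    have "(16 + pi\<^sup>2) * \<delta> / 64 < - (R * log_radius R)"
      using \<delta>(2) pos by (simp add: \<delta>0_def field_simps)
    then obtain \<rho> where \<rho>: "0 < \<rho>" "\<rho> < R" and crit: "- (\<rho> * log_radius \<rho>) = (16 + pi\<^sup>2) * \<delta> / 64"
      and \<rho>_eq: "\<rho> = (16 + pi\<^sup>2) * \<delta> / (- 64 * lambert_W_m1 (- ((16 + pi\<^sup>2) / 128) * exp (1 + euler_mascheroni) * \<delta>))"
      using exists_critical_radius[OF R _ \<delta>(1)] logR by auto
    define h where "h = reduced_energy \<delta>"
    have log_le: "log_radius x \<le> -1" if "0 < x" "x < R" for x
      using log_radius_mono[OF that] logR by linarith
    have h_less: "h \<rho> < h x" if "0 < x" "x < R" "x \<noteq> \<rho>" for x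
      unfolding h_def using that \<rho> log_le crit by (intro reduced_energy_unique_minimum) auto
    have h_le: "h \<rho> \<le> h x" if "0 < x" "x < R" for x
      using h_less[OF that] by (cases "x = \<rho>") auto
    \<comment> \<open>Only the difference of the centres enters the energy, so both are placed at
      the origin.\<close>
    define c0 :: config where "c0 = (\<rho>, \<rho>, 0, - pi, 0, 0)"
    have adm0: "c0 \<in> admissible L0"
      using \<rho> by (auto simp: c0_def admissible_def R_def)
    have F0: "F2 \<delta> c0 = 2 * h \<rho>"
      unfolding c0_def h_def F2_eq_reduced_energy[OF \<rho>(1) \<rho>(1)]
      using excess_eq_0_iff[of \<rho> 1 "-1" 0] \<rho> by simp
    have F2_eq: "F2 \<delta> (\<rho>1, \<rho>2, \<theta>1, \<theta>2, r1, r2) = h \<rho>1 + h \<rho>2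
        + \<delta> * excess \<rho>1 \<rho>2 (cos \<theta>1) (cos \<theta>2) (norm (r2 - r1) / sqrt (\<rho>1 * \<rho>2))"
      and adm: "0 < \<rho>1" "\<rho>1 < R" "0 < \<rho>2" "\<rho>2 < R" "\<theta>1 \<in> {-pi..<pi}" "\<theta>2 \<in> {-pi..<pi}"
      and nonneg: "0 \<le> \<delta> * excess \<rho>1 \<rho>2 (cos \<theta>1) (cos \<theta>2) (norm (r2 - r1) / sqrt (\<rho>1 * \<rho>2))"
      if "(\<rho>1, \<rho>2, \<theta>1, \<theta>2, r1, r2) \<in> admissible L0" for \<rho>1 \<rho>2 \<theta>1 \<theta>2 r1 r2
    proof -
      show a: "0 < \<rho>1" "\<rho>1 < R" "0 < \<rho>2" "\<rho>2 < R" "\<theta>1 \<in> {-pi..<pi}" "\<theta>2 \<in> {-pi..<pi}"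
        using that by (auto simp: admissible_def R_def)
      show "F2 \<delta> (\<rho>1, \<rho>2, \<theta>1, \<theta>2, r1, r2) = h \<rho>1 + h \<rho>2
        + \<delta> * excess \<rho>1 \<rho>2 (cos \<theta>1) (cos \<theta>2) (norm (r2 - r1) / sqrt (\<rho>1 * \<rho>2))"
        unfolding h_def by (rule F2_eq_reduced_energy[OF a(1,3)])
      show "0 \<le> \<delta> * excess \<rho>1 \<rho>2 (cos \<theta>1) (cos \<theta>2) (norm (r2 - r1) / sqrt (\<rho>1 * \<rho>2))"
        using \<delta> a by (intro mult_nonneg_nonneg excess_nonneg) auto
    qed
    have min: "2 * h \<rho> \<le> F2 \<delta> c" if "c \<in> admissible L0" for c
    proof -
      obtain \<rho>1 \<rho>2 \<theta>1 \<theta>2 r1 r2 where c: "c = (\<rho>1, \<rho>2, \<theta>1, \<theta>2, r1, r2)" by (cases c)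
      note a = that[unfolded c]
      show ?thesis
        using h_le[OF adm(1,2)[OF a]] h_le[OF adm(3,4)[OF a]] nonneg[OF a] unfolding c F2_eq[OF a] by linarith
    qed
    have "is_minimizer L0 \<delta> c0"
      using adm0 min by (auto simp: is_arg_min_linorder F0)
    moreover
    {
      fix \<rho>1 \<rho>2 \<theta>1 \<theta>2 :: real and r1 r2 :: "real ^ 2"
      assume "is_minimizer L0 \<delta> (\<rho>1, \<rho>2, \<theta>1, \<theta>2, r1, r2)"
      then have a: "(\<rho>1, \<rho>2, \<theta>1, \<theta>2, r1, r2) \<in> admissible L0"
        and le: "F2 \<delta> (\<rho>1, \<rho>2, \<theta>1, \<theta>2, r1, r2) \<le> 2 * h \<rho>"
        using adm0 unfolding F0[symmetric] is_arg_min_linorder by blast+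
      note a' = adm[OF a]
      \<comment> \<open>The energy exceeds \<open>2 * h \<rho>\<close> by three nonnegative amounts,
        one for each radius and one for the excess; at a minimizer all three vanish.\<close>
      have "h \<rho>1 \<le> h \<rho>" "h \<rho>2 \<le> h \<rho>"
        and ex: "\<delta> * excess \<rho>1 \<rho>2 (cos \<theta>1) (cos \<theta>2) (norm (r2 - r1) / sqrt (\<rho>1 * \<rho>2)) = 0"
        using h_le[OF a'(1,2)] h_le[OF a'(3,4)] nonneg[OF a] le unfolding F2_eq[OF a] by linarith+
      then have eq: "\<rho>1 = \<rho>" "\<rho>2 = \<rho>"
        using h_less[OF a'(1,2)] h_less[OF a'(3,4)] by force+
      have "excess \<rho> \<rho> (cos \<theta>1) (cos \<theta>2) (norm (r2 - r1) / sqrt (\<rho> * \<rho>)) = 0"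
        using ex \<delta> unfolding eq by simp
      then have "norm (r2 - r1) / sqrt (\<rho> * \<rho>) = 0 \<and> cos \<theta>1 = 1 \<and> cos \<theta>2 = -1"
        using \<rho> by (subst (asm) excess_eq_0_iff) auto
      then have "r1 = r2 \<and> \<theta>1 = 0 \<and> \<theta>2 = - pi"
        using \<rho> a' cos_eq_1_imp_0 cos_eq_minus_1_imp by auto
      then have "r1 = r2 \<and> \<theta>1 = 0 \<and> \<theta>2 = - pi \<and> \<rho>1 = \<rho>2 \<and> \<rho>1 = (16 + pi\<^sup>2) * \<delta> /
         (- 64 * lambert_W_m1 (- ((16 + pi\<^sup>2) / 128) * exp (1 + euler_mascheroni) * \<delta>))"
        using eq \<rho>_eq by simp
    }
    ultimately have "(\<exists>c. is_minimizer L0 \<delta> c) \<and>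
    (\<forall>\<rho>1 \<rho>2 \<theta>1 \<theta>2 r1 r2. is_minimizer L0 \<delta> (\<rho>1, \<rho>2, \<theta>1, \<theta>2, r1, r2) \<longrightarrow>
       r1 = r2 \<and>
       \<theta>1 = 0 \<and> \<theta>2 = - pi \<and>
       \<rho>1 = \<rho>2 \<and>
       \<rho>1 = (16 + pi\<^sup>2) * \<delta> /
         (- 64 * lambert_W_m1 (- ((16 + pi\<^sup>2) / 128) * exp (1 + euler_mascheroni) * \<delta>)))"
      by blast
  }
  ultimately show ?thesis by blast
qed

end
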